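(* Let $b>0$, $0<\nu<1$, $0<\mu<1$, $q\ge 1$, $\gamma>0$, let $\flat\ge 2$ be an integer, and let $0\le\xi_1<\dots<\xi_\flat\le 1$ be arbitrary collocation parameters. Let $a,\chi\in C(\Lambda)$, $\mathscr K\in C(D_R)$, $\varphi_b\in\mathbb R$, let $\varphi$ be the solution of the adjoint Volterra integro-differential equation $$\varphi'(x)=a(x)\varphi(x)+\chi(x)+\int_x^b (s-x)^{\nu-1}\mathscr K(x,s)\varphi(s)\,ds,\quad 0\le x\le b,\qquad \varphi(b)=\varphi_b,$$ and let $\psi:=\varphi'$. Suppose that $\widehat\psi(\rho):=\psi(\tau(\rho))\in C^{\flat,1-\gamma}[b-b^\mu,b)$. Then there exist an integer $\mathscr M_0\in\mathbb N$ and a constant $C$, independent of $\mathscr M$, such that, whenever $\mathscr M>\mathscr M_0$, the collocation approximations $\psi_h$ and $\varphi_h$ (defined in the context) satisfy $$\|\psi-\psi_h\|_{L^\infty(\Lambda)}\le C\begin{cases}\mathscr M^{-\min\{q\mu\flat,\flat\}},&\flat<\gamma,\\ \mathscr M^{-\min\{q\mu\flat,\flat\}}\ln\mathscr M,&\flat=\gamma,\\ \mathscr M^{-\min\{q\mu\gamma,\flat\}},&\flat>\gamma,\end{cases}$$ and $$\|\varphi-\varphi_h\|_{L^\infty(\Lambda)}\le C\begin{cases}\varpi\bigl(q(1+\mu\min\{\flat,\gamma\}),\flat;\mathscr M\bigr),&\flat\ne\gamma,\\ \varpi\bigl(q(\mu\flat+1),\flat;\mathscr M\bigr)\ln\mathscr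 M,&\flat=\gamma.\end{cases}$$
   Context: $\mathbb N=\{1,2,\dots\}$, $\Lambda:=[0,b]$, $D_R:=\{(x,s):0\le x\le s\le b\}$, and $\tau(\rho):=b-(b-\rho)^{1/\mu}$ for $\rho\in[b-b^\mu,b]$. Mesh. For $\mathscr M\in\mathbb N$ set $x_j=b\bigl(1-(\frac{\mathscr M-j}{\mathscr M})^q\bigr)$, $j=0,\dots,\mathscr M$; $\varrho_j=(x_{j-1},x_j]$; $\rho_j=b-(b-x_j)^\mu$; $h_{j,\mu}=\rho_j-\rho_{j-1}$. Collocation points: $x_{j,l}=\tau(\eta_{j,l})$ with $\eta_{j,l}=\rho_{j-1}+\xi_l h_{j,\mu}$, $j=1,\dots,\mathscr M$, $l=1,\dots,\flat$. Fractional backward Lagrange basis on (the closure of) $\varrho_j$: $$L_{j,l}^{\mu}(x)=\prod_{i\ne l,\,1\le i\le\flat}\frac{(b-x)^{\mu}-(b-x_{j,i})^{\mu}}{(b-x_{j,l})^{\mu}-(b-x_{j,i})^{\mu}}.$$ Collocation approximations. $\psi_h$ is, on each $\varrho_j$, of the form $\psi_h(x)=\sum_{k=1}^{\flat}Y_{j,k}L_{j,k}^\mu(x)$, where $Y_{j,k}=\psi_h(x_{j,k})$ (value of the $j$-th piece), and $\varphi_h$ is defined by $\varphi_h(b)=\varphi_b$ and $\varphi_h(x)=\varphi_h(x_j)-\int_x^{x_j}\psi_h(s)\,ds$ for $x\in[x_{j-1},x_j]$, $j=\mathscr M,\dots,1$. The coefficients $Y_{j,l}$ are determined by the collocation equations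 $$Y_{j,l}=a(x_{j,l})\varphi_h(x_{j,l})+\chi(x_{j,l})+\int_{x_{j,l}}^{b}(s-x_{j,l})^{\nu-1}\mathscr K(x_{j,l},s)\varphi_h(s)\,ds,\qquad 1\le j\le\mathscr M,\ 1\le l\le\flat.$$ Regularity class. For $m\in\mathbb N$ and $\gamma>0$, $C^{m,1-\gamma}[b-b^\mu,b)$ is the set of real-valued $f\in C[b-b^\mu,b]\cap C^m[b-b^\mu,b)$ such that, for some constants $c_k=c_k(f)$ and all $b-b^\mu\le\rho<b$, $k=0,\dots,m$: $|f^{(k)}(\rho)|\le c_k$ if $k<\gamma$; $|f^{(k)}(\rho)|\le c_k(1+|\ln(b-\rho)|)$ if $k=\gamma$; $|f^{(k)}(\rho)|\le c_k(b-\rho)^{\gamma-k}$ if $k>\gamma$. For $r,s>0$: $\varpi(r,s;\mathscr M)=\mathscr M^{-\min\{r,s\}}$ if $r\ne s$, and $\varpi(r,s;\mathscr M)=\mathscr M^{-\min\{r,s\}}\ln\mathscr M$ if $r=s$. *)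

theory Defs
  imports "HOL-Probability.Essential_Supremum"
begin

definition tau :: "real \<Rightarrow> real \<Rightarrow> real \<Rightarrow> real" where
  "tau b \<mu> \<rho> = b - (b - \<rho>) powr (1 / \<mu>)"

definition node :: "real \<Rightarrow> real \<Rightarrow> nat \<Rightarrow> nat \<Rightarrow> real" where
  "node b q M j = b * (1 - ((real M - real j) / real M) powr q)"

definition rho_node :: "real \<Rightarrow> real \<Rightarrow> real \<Rightarrow> nat \<Rightarrow> nat \<Rightarrow> real" where
  "rho_node b \<mu> q M j = b - (b - node b q M j) powr \<mu>"

definition rho_step :: "real \<Rightarrow> real \<Rightarrow> real \<Rightarrow> nat \<Rightarrow> nat \<Rightarrow> real" where
  "rho_step b \<mu> q M j = rho_node b \<mu> q M j - rho_node b \<mu> q M (j - 1)"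

definition colloc_pt ::
  "real \<Rightarrow> real \<Rightarrow> real \<Rightarrow> (nat \<Rightarrow> real) \<Rightarrow> nat \<Rightarrow> nat \<Rightarrow> nat \<Rightarrow> real" where
  "colloc_pt b \<mu> q \<xi> M j l =
     tau b \<mu> (rho_node b \<mu> q M (j - 1) + \<xi> l * rho_step b \<mu> q M j)"

definition frac_lagrange ::
  "real \<Rightarrow> real \<Rightarrow> real \<Rightarrow> nat \<Rightarrow> (nat \<Rightarrow> real) \<Rightarrow> nat \<Rightarrow> nat \<Rightarrow> nat \<Rightarrow> real \<Rightarrow> real" where
  "frac_lagrange b \<mu> q n \<xi> M j l x =
     (\<Prod>i\<in>{1..n} - {l}.
        ((b - x) powr \<mu> - (b - colloc_pt b \<mu> q \<xi> M j i) powr \<mu>) /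
        ((b - colloc_pt b \<mu> q \<xi> M j l) powr \<mu> - (b - colloc_pt b \<mu> q \<xi> M j i) powr \<mu>))"

text \<open>The right-hand side of the adjoint Volterra integro-differential equation, for a
  candidate function in place of the solution. The integrals below are absolutely convergent
  for continuous data, so the Henstock--Kurzweil integral agrees with the Lebesgue integral.\<close>

definition avide_rhs ::
  "real \<Rightarrow> real \<Rightarrow> (real \<Rightarrow> real) \<Rightarrow> (real \<Rightarrow> real) \<Rightarrow> (real \<Rightarrow> real \<Rightarrow> real)
    \<Rightarrow> (real \<Rightarrow> real) \<Rightarrow> real \<Rightarrow> real" where
  "avide_rhs b \<nu> a chi K \<phi> x =
     a x * \<phi> x + chi x + integral {x..b} (\<lambda>s. (s - x) powr (\<nu> - 1) * K x s * \<phi> s)"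

text \<open>The function \<open>\<psi>\<close> is the derivative of \<open>\<phi>\<close> on \<open>[0,b]\<close> (one-sided at the end points).\<close>

definition avide_solution ::
  "real \<Rightarrow> real \<Rightarrow> (real \<Rightarrow> real) \<Rightarrow> (real \<Rightarrow> real) \<Rightarrow> (real \<Rightarrow> real \<Rightarrow> real) \<Rightarrow> real
    \<Rightarrow> (real \<Rightarrow> real) \<Rightarrow> (real \<Rightarrow> real) \<Rightarrow> bool" where
  "avide_solution b \<nu> a chi K \<phi>b \<phi> \<psi> \<longleftrightarrow>
     (\<forall>x\<in>{0..b}. (\<phi> has_real_derivative \<psi> x) (at x within {0..b}) \<and>
                 \<psi> x = avide_rhs b \<nu> a chi K \<phi> x) \<and>
     \<phi> b = \<phi>b"

text \<open>\<open>Y j k\<close> is the coefficient of the \<open>k\<close>-th basis function on the \<open>j\<close>-th mesh interval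
  \<open>(x\<^bsub>j-1\<^esub>, x\<^bsub>j\<^esub>]\<close>. When \<open>\<xi> 1 = 0\<close> the collocation point with \<open>k = 1\<close> is the excluded left end
  point, and \<open>Y j 1\<close> is then the value there of the \<open>j\<close>-th piece, not of \<open>\<psi>h\<close>. That
  \<open>Y j k\<close> is the value of the \<open>j\<close>-th piece at the \<open>k\<close>-th collocation point need not be
  demanded: the Lagrange basis is cardinal at these points. The mesh intervals leave \<open>\<psi>h 0\<close>
  unspecified; this affects neither the integrals nor the essential supremum.\<close>

definition collocation_approx ::
  "real \<Rightarrow> real \<Rightarrow> real \<Rightarrow> real \<Rightarrow> nat \<Rightarrow> (nat \<Rightarrow> real)
    \<Rightarrow> (real \<Rightarrow> real) \<Rightarrow> (real \<Rightarrow> real) \<Rightarrow> (real \<Rightarrow> real \<Rightarrow> real) \<Rightarrow> real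
    \<Rightarrow> nat \<Rightarrow> (nat \<Rightarrow> nat \<Rightarrow> real) \<Rightarrow> (real \<Rightarrow> real) \<Rightarrow> (real \<Rightarrow> real) \<Rightarrow> bool" where
  "collocation_approx b \<nu> \<mu> q n \<xi> a chi K \<phi>b M Y \<psi>h \<phi>h \<longleftrightarrow>
     (\<forall>j\<in>{1..M}. \<forall>x\<in>{node b q M (j - 1)<..node b q M j}.
        \<psi>h x = (\<Sum>k=1..n. Y j k * frac_lagrange b \<mu> q n \<xi> M j k x)) \<and>
     \<phi>h b = \<phi>b \<and>
     (\<forall>j\<in>{1..M}. \<forall>x\<in>{node b q M (j - 1)..node b q M j}.
        \<phi>h x = \<phi>h (node b q M j) - integral {x..node b q M j} \<psi>h) \<and>
     (\<forall>j\<in>{1..M}. \<forall>l\<in>{1..n}.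
        Y j l = avide_rhs b \<nu> a chi K \<phi>h (colloc_pt b \<mu> q \<xi> M j l))"

text \<open>The class \<open>C\<^bsup>m,1-\<gamma>\<^esup>[b - b\<^bsup>\<mu>\<^esup>, b)\<close>; \<open>D k\<close> is the \<open>k\<close>-th derivative of \<open>f\<close> on the half-open
  interval (one-sided at the left end point), and is uniquely determined there by \<open>f\<close>.\<close>

definition weighted_C ::
  "nat \<Rightarrow> real \<Rightarrow> real \<Rightarrow> real \<Rightarrow> (real \<Rightarrow> real) set" where
  "weighted_C m \<gamma> b \<mu> = {f.
     continuous_on {b - b powr \<mu>..b} f \<and>
     (\<exists>D :: nat \<Rightarrow> real \<Rightarrow> real. \<exists>c :: nat \<Rightarrow> real.
        (\<forall>\<rho>\<in>{b - b powr \<mu>..<b}. D 0 \<rho> = f \<rho>) \<and>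
        (\<forall>k<m. \<forall>\<rho>\<in>{b - b powr \<mu>..<b}.
           (D k has_real_derivative D (Suc k) \<rho>) (at \<rho> within {b - b powr \<mu>..<b})) \<and>
        (\<forall>k\<le>m. continuous_on {b - b powr \<mu>..<b} (D k)) \<and>
        (\<forall>k\<le>m. \<forall>\<rho>\<in>{b - b powr \<mu>..<b}.
           \<bar>D k \<rho>\<bar> \<le> (if real k < \<gamma> then c k
                       else if real k = \<gamma> then c k * (1 + \<bar>ln (b - \<rho>)\<bar>)
                       else c k * (b - \<rho>) powr (\<gamma> - real k))))}"

definition varpi :: "real \<Rightarrow> real \<Rightarrow> nat \<Rightarrow> real" where
  "varpi r s M =
     (if r \<noteq> s then real M powr (- min r s) else real M powr (- min r s) * ln (real M))"

definition Linf_norm :: "real \<Rightarrow> (real \<Rightarrow> real) \<Rightarrow> ereal" where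
  "Linf_norm b f = esssup (lebesgue_on {0..b}) (\<lambda>x. ereal \<bar>f x\<bar>)"

end

theory Submission
  imports Defs "HOL-Computational_Algebra.Polynomial"
begin

text \<open>Two ingredients carry the proof: a stability estimate on fine meshes, and a local
  interpolation error that is summed over the graded mesh.

  \<^bold>\<open>Stability.\<close> In the variable \<open>\<rho> = b - (b - x) powr \<mu>\<close> the fractional basis is the polynomial Lagrange basis,
  so interpolation at the collocation points is bounded on every cell by a constant that depends on
  the parameters \<open>\<xi>\<close> only (\<open>abs_lagrange_sum_le\<close>). At the collocation points \<open>\<psi> - \<psi>h\<close> is a difference of
  right-hand sides, and \<open>\<phi> - \<phi>h\<close> is, up to sign, the integral of \<open>\<psi> - \<psi>h\<close> from \<open>x\<close> to \<open>b\<close>. The weakly singular kernel is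
  integrable, hence \<open>\<psi> - \<psi>h\<close> is at most the interpolation error of \<open>\<psi>\<close> plus a constant times the supremum of
  \<open>\<phi> - \<phi>h\<close> to the right of the left end of the current cell. In an exponentially weighted norm this Volterra
  structure is a contraction on fine meshes (\<open>weighted_volterra_bound\<close>). The one estimate gives solvability by
  Banach's fixed point theorem (\<open>collocation_solvable\<close>), uniqueness (\<open>collocation_unique\<close>), and the error bound
  (\<open>collocation_error\<close>): \<open>\<phi> - \<phi>h\<close> is controlled by the integral, and \<open>\<psi> - \<psi>h\<close> by the supremum, of the
  interpolation error of \<open>\<psi>\<close>.

  \<^bold>\<open>Interpolation on the graded mesh.\<close> Number the cells from the singular end, \<open>i = M - j\<close>, and let \<open>r = q * \<mu>\<close> and
  \<open>g = min n \<gamma>\<close>. A Taylor expansion at the left end of the cell, the end away from the singularity, shows that the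
  interpolation error is of order \<open>M powr (- r * g) * Suc i powr (r * g - n)\<close>, with an additional \<open>ln M\<close> if
  \<open>n = \<gamma>\<close> (\<open>taylor_cell_bound\<close>). Its maximum over \<open>i\<close> is \<open>M powr (- min (r * g) n)\<close>, the rate for \<open>\<psi>\<close>
  (\<open>grading_sup_le\<close>). For the integral, the cell lengths in the variable \<open>x\<close>, of order
  \<open>M powr (- q) * Suc i powr (q - 1)\<close>, are multiplied in. The result is a power sum with exponent
  \<open>q * (1 + \<mu> * g) - 1 - n\<close>, which yields \<open>varpi (q * (1 + \<mu> * g)) n M\<close>, the rate for \<open>\<phi>\<close>
  (\<open>graded_cell_sum_le\<close>).\<close>

section \<open>Polynomial interpolation on the unit interval\<close>

definition lagrange_basis :: "(nat \<Rightarrow> real) \<Rightarrow> nat set \<Rightarrow> nat \<Rightarrow> real \<Rightarrow> real" where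
  "lagrange_basis \<xi> I l \<theta> = (\<Prod>i\<in>I - {l}. (\<theta> - \<xi> i) / (\<xi> l - \<xi> i))"

text \<open>The \<open>l\<close>-th summand bounds \<open>\<bar>lagrange_basis \<xi> I l \<theta>\<bar>\<close> for all \<open>\<theta>\<close> and all nodes in the unit
  interval, where numerators have absolute value at most one. The sum is therefore an upper bound
  for the Lebesgue constant, uniform over all cells and meshes.\<close>
definition lebesgue_bound :: "(nat \<Rightarrow> real) \<Rightarrow> nat set \<Rightarrow> real" where
  "lebesgue_bound \<xi> I = (\<Sum>l\<in>I. \<Prod>i\<in>I - {l}. 1 / \<bar>\<xi> l - \<xi> i\<bar>)"

lemma lagrange_basis_at_node:
  assumes "finite I" "inj_on \<xi> I" "l \<in> I" "k \<in> I"
  shows "lagrange_basis \<xi> I l (\<xi> k) = (if k = l then 1 else 0)"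
proof (cases "k = l")
  case True
  have "\<And>i. i \<in> I - {l} \<Longrightarrow> \<xi> l - \<xi> i \<noteq> 0"
    using assms by (auto dest: inj_onD)
  then show ?thesis
    using True unfolding lagrange_basis_def by (simp add: prod.neutral)
next
  case False
  then have "k \<in> I - {l}" using assms by auto
  then show ?thesis
    using False assms unfolding lagrange_basis_def by (auto intro!: prod_zero)
qed

text \<open>The interpolant and \<open>p\<close> are polynomials of degree less than \<open>card I\<close> that agree at \<open>card I\<close>
  points.\<close>
lemma lagrange_interpolation_poly:
  fixes p :: "real poly"
  assumes "finite I" "inj_on \<xi> I" "degree p < card I"
  shows "(\<Sum>l\<in>I. poly p (\<xi> l) * lagrange_basis \<xi> I l \<theta>) = poly p \<theta>"
proof -
  define B where "B l = (\<Prod>i\<in>I - {l}. [:- \<xi> i / (\<xi> l - \<xi> i), 1 / (\<xi> l - \<xi> i):])" for l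
  define Q where "Q = (\<Sum>l\<in>I. smult (poly p (\<xi> l)) (B l))"
  have B: "poly (B l) t = lagrange_basis \<xi> I l t" for l t
    unfolding B_def lagrange_basis_def poly_prod
    by (intro prod.cong) (auto simp: diff_divide_distrib)
  have Q: "poly Q t = (\<Sum>l\<in>I. poly p (\<xi> l) * lagrange_basis \<xi> I l t)" for t
    by (simp add: Q_def poly_sum B)
  have "degree (B l) \<le> card I - 1" if "l \<in> I" for l
  proof -
    have "degree (B l) \<le> (\<Sum>i\<in>I - {l}. degree [:- \<xi> i / (\<xi> l - \<xi> i), 1 / (\<xi> l - \<xi> i):])"
      unfolding B_def using degree_prod_sum_le[of "I - {l}" "\<lambda>i. [:- \<xi> i / (\<xi> l - \<xi> i), 1 / (\<xi> l - \<xi> i):]"] assms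
      by (simp add: o_def)
    also have "\<dots> \<le> (\<Sum>i\<in>I - {l}. 1)" by (intro sum_mono) auto
    also have "\<dots> = card I - 1" using that assms by simp
    finally show ?thesis .
  qed
  then have "degree Q \<le> card I - 1"
    unfolding Q_def by (intro degree_sum_le) (use assms in \<open>auto intro: degree_smult_le order_trans\<close>)
  then have deg: "degree (Q - p) < card I"
    using assms degree_diff_less[of Q "card I" p] by linarith
  have "poly (Q - p) (\<xi> k) = 0" if "k \<in> I" for k
  proof -
    have "poly Q (\<xi> k) = (\<Sum>l\<in>I. if l = k then poly p (\<xi> l) else 0)"
      unfolding Q by (intro sum.cong) (use that assms lagrange_basis_at_node in auto)
    then show ?thesis using that assms by simp
  qed
  then have sub: "\<xi> ` I \<subseteq> {x. poly (Q - p) x = 0}" by auto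
  have "Q - p = 0"
  proof (rule ccontr)
    assume nz: "Q - p \<noteq> 0"
    have "card I = card (\<xi> ` I)" using assms by (simp add: card_image)
    also have "\<dots> \<le> card {x. poly (Q - p) x = 0}"
      by (intro card_mono poly_roots_finite nz sub)
    also have "\<dots> \<le> degree (Q - p)" by (rule card_poly_roots_bound[OF nz])
    finally show False using deg by simp
  qed
  then show ?thesis using Q[of \<theta>] by simp
qed

lemma sum_abs_lagrange_basis_le:
  assumes "finite I" "\<xi> ` I \<subseteq> {0..1}" "\<theta> \<in> {0..1}"
  shows "(\<Sum>l\<in>I. \<bar>lagrange_basis \<xi> I l \<theta>\<bar>) \<le> lebesgue_bound \<xi> I"
  unfolding lebesgue_bound_def
proof (rule sum_mono)
  fix l assume "l \<in> I"
  have "\<bar>lagrange_basis \<xi> I l \<theta>\<bar> = (\<Prod>i\<in>I - {l}. \<bar>(\<theta> - \<xi> i) / (\<xi> l - \<xi> i)\<bar>)"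
    by (simp add: lagrange_basis_def abs_prod)
  also have "\<dots> \<le> (\<Prod>i\<in>I - {l}. 1 / \<bar>\<xi> l - \<xi> i\<bar>)"
  proof (rule prod_mono)
    fix i assume "i \<in> I - {l}"
    then have "\<xi> i \<in> {0..1}" using assms by auto
    then have "\<bar>\<theta> - \<xi> i\<bar> \<le> 1" using assms by auto
    then show "0 \<le> \<bar>(\<theta> - \<xi> i) / (\<xi> l - \<xi> i)\<bar> \<and>
        \<bar>(\<theta> - \<xi> i) / (\<xi> l - \<xi> i)\<bar> \<le> 1 / \<bar>\<xi> l - \<xi> i\<bar>"
      by (simp add: divide_right_mono)
  qed
  finally show "\<bar>lagrange_basis \<xi> I l \<theta>\<bar> \<le> (\<Prod>i\<in>I - {l}. 1 / \<bar>\<xi> l - \<xi> i\<bar>)" .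
qed

lemma lebesgue_bound_nonneg: "0 \<le> lebesgue_bound \<xi> I"
  unfolding lebesgue_bound_def by (intro sum_nonneg prod_nonneg) auto

lemma abs_lagrange_sum_le:
  assumes "finite I" "\<xi> ` I \<subseteq> {0..1}" "\<theta> \<in> {0..1}"
    and "\<And>l. l \<in> I \<Longrightarrow> \<bar>y l\<bar> \<le> B" and "0 \<le> B"
  shows "\<bar>\<Sum>l\<in>I. y l * lagrange_basis \<xi> I l \<theta>\<bar> \<le> lebesgue_bound \<xi> I * B"
proof -
  have "\<bar>\<Sum>l\<in>I. y l * lagrange_basis \<xi> I l \<theta>\<bar> \<le> (\<Sum>l\<in>I. B * \<bar>lagrange_basis \<xi> I l \<theta>\<bar>)"
    by (rule order_trans[OF sum_abs], rule sum_mono)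
       (auto simp: abs_mult intro!: mult_right_mono assms)
  also have "\<dots> \<le> B * lebesgue_bound \<xi> I"
    unfolding sum_distrib_left[symmetric]
    by (intro mult_left_mono sum_abs_lagrange_basis_le assms)
  finally show ?thesis by (simp add: mult.commute)
qed

text \<open>Interpolation reproduces the polynomial \<open>\<Sum>k<n. c k * t ^ k\<close>, so the error of \<open>F\<close> equals the error
  of the difference between \<open>F\<close> and this polynomial. Hence any approximation by a polynomial, for
  instance a Taylor polynomial, controls the interpolation error.\<close>
lemma lagrange_interpolation_error:
  assumes "inj_on \<xi> I" "finite I" "\<xi> ` I \<subseteq> {0..1}" "card I = n" "n > 0"
    and close: "\<And>t. t \<in> {0..1} \<Longrightarrow> \<bar>F t - (\<Sum>k<n. c k * t ^ k)\<bar> \<le> B"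
    and \<theta>: "\<theta> \<in> {0..1}"
  shows "\<bar>F \<theta> - (\<Sum>l\<in>I. F (\<xi> l) * lagrange_basis \<xi> I l \<theta>)\<bar>
           \<le> (1 + lebesgue_bound \<xi> I) * B"
proof -
  define p where "p = (\<Sum>k<n. monom (c k) k)"
  have p: "poly p t = (\<Sum>k<n. c k * t ^ k)" for t
    by (simp add: p_def poly_sum poly_monom)
  have "degree p < card I"
    unfolding p_def assms(4)
  proof -
    have "degree (\<Sum>k<n. monom (c k) k) \<le> n - 1"
      by (intro degree_sum_le) (auto intro: order_trans[OF degree_monom_le])
    then show "degree (\<Sum>k<n. monom (c k) k) < n" using \<open>n > 0\<close> by linarith
  qed
  then have rep: "(\<Sum>l\<in>I. poly p (\<xi> l) * lagrange_basis \<xi> I l \<theta>) = poly p \<theta>"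
    by (intro lagrange_interpolation_poly assms)
  have B: "0 \<le> B" using close[OF \<theta>] by linarith
  have "\<bar>\<Sum>l\<in>I. (F (\<xi> l) - poly p (\<xi> l)) * lagrange_basis \<xi> I l \<theta>\<bar> \<le> lebesgue_bound \<xi> I * B"
    by (intro abs_lagrange_sum_le assms B) (use assms(3) close p in auto)
  moreover have "\<bar>F \<theta> - poly p \<theta>\<bar> \<le> B" using close[OF \<theta>] p by simp
  moreover have "F \<theta> - (\<Sum>l\<in>I. F (\<xi> l) * lagrange_basis \<xi> I l \<theta>) = (F \<theta> - poly p \<theta>)
     - (\<Sum>l\<in>I. (F (\<xi> l) - poly p (\<xi> l)) * lagrange_basis \<xi> I l \<theta>)"
    by (simp add: left_diff_distrib sum_subtractf rep)
  ultimately show ?thesis by (simp add: algebra_simps abs_le_iff)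
qed

section \<open>Volterra inequalities on a mesh\<close>

definition mesh_cell :: "(nat \<Rightarrow> real) \<Rightarrow> real \<Rightarrow> nat" where
  "mesh_cell X s = (LEAST j. s \<le> X j)"

lemma mesh_cell_eq:
  assumes "mono_on {..M} X" "j \<in> {1..M}" "s \<in> {X (j - 1)<..X j}"
  shows "mesh_cell X s = j"
  unfolding mesh_cell_def
proof (rule Least_equality)
  show "s \<le> X j" using assms by simp
  fix i assume i: "s \<le> X i"
  show "j \<le> i"
  proof (rule ccontr)
    assume "\<not> j \<le> i"
    then have "X i \<le> X (j - 1)" using assms by (intro mono_onD[OF assms(1)]) auto
    then show False using i assms by auto
  qed
qed

lemma mesh_cell_exists:
  fixes X :: "nat \<Rightarrow> real"
  assumes "X 0 < s" "s \<le> X M"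
  obtains j where "j \<in> {1..M}" "s \<in> {X (j - 1)<..X j}"
proof -
  define j where "j = mesh_cell X s"
  have sj: "s \<le> X j" unfolding j_def mesh_cell_def by (rule LeastI[of _ M]) fact
  have "j \<le> M" unfolding j_def mesh_cell_def by (rule Least_le) fact
  moreover have "j \<noteq> 0" using sj assms by (metis not_less)
  moreover have "\<not> s \<le> X (j - 1)"
    using not_less_Least[of "j - 1" "\<lambda>j. s \<le> X j"] \<open>j \<noteq> 0\<close>
    unfolding j_def mesh_cell_def by auto
  ultimately show ?thesis using sj that[of j] by auto
qed

lemma has_integral_mesh:
  fixes f :: "real \<Rightarrow> real" and X :: "nat \<Rightarrow> real"
  assumes "mono_on {..M} X"
    and "\<And>j. j \<in> {1..M} \<Longrightarrow> (f has_integral I j) {X (j - 1)..X j}"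
  shows "(f has_integral (\<Sum>j=1..M. I j)) {X 0..X M}"
  using assms
proof (induction M)
  case 0 then show ?case by (simp add: has_integral_refl)
next
  case (Suc M)
  have "(f has_integral (\<Sum>j=1..M. I j)) {X 0..X M}"
    by (intro Suc.IH) (use Suc.prems in \<open>auto intro: mono_on_subset\<close>)
  moreover have "(f has_integral I (Suc M)) {X M..X (Suc M)}"
    using Suc.prems(2)[of "Suc M"] by simp
  moreover have "X 0 \<le> X M" "X M \<le> X (Suc M)"
    by (auto intro!: mono_onD[OF Suc.prems(1)])
  ultimately show ?case
    using has_integral_combine[of "X 0" "X M" "X (Suc M)" f "\<Sum>j=1..M. I j" "I (Suc M)"] by simp
qed

lemma has_integral_mesh_step:
  assumes "mono_on {..M} X"
  shows "((\<lambda>s. g (mesh_cell X s)) has_integral (\<Sum>j=1..M. g j * (X j - X (j - 1)))) {X 0..X M}"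
proof (rule has_integral_mesh[OF assms])
  fix j assume j: "j \<in> {1..M}"
  have "X (j - 1) \<le> X j" using j by (intro mono_onD[OF assms]) auto
  then have "((\<lambda>s. g j) has_integral (g j * (X j - X (j - 1)))) {X (j - 1)..X j}"
    using has_integral_const_real[of "g j" "X (j - 1)" "X j"] by (simp add: mult.commute)
  then show "((\<lambda>s. g (mesh_cell X s)) has_integral (g j * (X j - X (j - 1)))) {X (j - 1)..X j}"
    by (rule has_integral_spike_finite[of "{X (j - 1)}", rotated 2])
       (use mesh_cell_eq[OF assms j] in auto)
qed

text \<open>This is the contraction estimate behind existence, uniqueness and stability. In the norm with
  weight \<open>exp (4 * A * (b - x))\<close>, integration from \<open>x\<close> to \<open>b\<close> gains a factor \<open>1 / (4 * A)\<close>. The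
  bound on \<open>e s\<close> looks at \<open>d\<close> slightly to the left of \<open>s\<close>, down to the left end of the cell
  (a collocation method is implicit inside each cell), and this costs at most a factor 2 on a
  fine mesh. Altogether the constant \<open>A\<close> becomes \<open>1 / 2\<close>.\<close>
lemma weighted_volterra_bound:
  fixes X :: "nat \<Rightarrow> real" and d e :: "real \<Rightarrow> real"
  assumes mesh: "mono_on {..M} X" "X 0 = 0" "X M = b"
    and size: "\<And>j. j \<in> {1..M} \<Longrightarrow> X j - X (j - 1) \<le> H" and H: "exp (4 * A * H) \<le> 2"
    and A: "0 < A"
    and e: "e integrable_on {0..b}"
    and N: "0 \<le> N" "\<And>s. s \<in> {0..b} \<Longrightarrow> \<bar>d s\<bar> \<le> N * exp (4 * A * (b - s))"
    and g: "\<And>j. j \<in> {1..M} \<Longrightarrow> 0 \<le> g j"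
    and loc: "\<And>j s B. \<lbrakk>j \<in> {1..M}; s \<in> {X (j - 1)<..X j}; 
                \<And>t. t \<in> {X (j - 1)..b} \<Longrightarrow> \<bar>d t\<bar> \<le> B\<rbrakk> \<Longrightarrow> \<bar>e s\<bar> \<le> g j + A * B"
    and x: "x \<in> {0..b}"
  shows "\<bar>integral {x..b} e\<bar> \<le> (\<Sum>j=1..M. g j * (X j - X (j - 1))) + N / 2 * exp (4 * A * (b - x))"
proof -
  define w where "w s = exp (4 * A * (b - s))" for s
  \<comment> \<open>The point 0 belongs to no cell; there \<open>G\<close> is given a value for which the bound is trivial.\<close>
  define G where "G s = (if s = 0 then \<bar>e 0\<bar> else g (mesh_cell X s))" for s
  have step: "((\<lambda>s. g (mesh_cell X s)) has_integral (\<Sum>j=1..M. g j * (X j - X (j - 1)))) {0..b}"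
    using has_integral_mesh_step[OF mesh(1), of g] mesh by simp
  have Gint: "(G has_integral (\<Sum>j=1..M. g j * (X j - X (j - 1)))) {0..b}"
    by (rule has_integral_spike_finite[OF _ _ step, of "{0}"]) (auto simp: G_def)
  have cell: "\<exists>j. j \<in> {1..M} \<and> s \<in> {X (j - 1)<..X j}" if "s \<in> {0..b}" "s \<noteq> 0" for s
    using mesh_cell_exists[of X s M] that mesh by auto
  have G0: "0 \<le> G s" if "s \<in> {0..b}" for s
    using cell[OF that] mesh_cell_eq[OF mesh(1)] g by (auto simp: G_def)
  have bound: "norm (e s) \<le> G s + 2 * A * N * w s" if s: "s \<in> {x..b}" for s
  proof (cases "s = 0")
    case True then show ?thesis using A N by (simp add: G_def w_def)
  next
    case False
    have s': "s \<in> {0..b}" using s x by auto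
    obtain j where j: "j \<in> {1..M}" "s \<in> {X (j - 1)<..X j}" using cell[OF s' False] by auto
    have X0: "0 \<le> X (j - 1)" using mono_onD[OF mesh(1), of 0 "j - 1"] mesh j by auto
    \<comment> \<open>Passing from \<open>s\<close> to the left end of its cell costs the factor \<open>exp (4 * A * H) \<le> 2\<close>.\<close>
    have "w (X (j - 1)) \<le> exp (4 * A * H) * w s"
    proof -
      have "X j - X (j - 1) \<le> H" "s \<le> X j" using size j by auto
      then have "4 * A * (b - X (j - 1)) \<le> 4 * A * (H + (b - s))"
        using A by (intro mult_left_mono) auto
      then show ?thesis by (simp add: w_def exp_add[symmetric] algebra_simps)
    qed
    also have "\<dots> \<le> 2 * w s" using H by (intro mult_right_mono) (auto simp: w_def)
    finally have w: "w (X (j - 1)) \<le> 2 * w s" .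
    have "\<bar>d t\<bar> \<le> N * w (X (j - 1))" if t: "t \<in> {X (j - 1)..b}" for t
    proof -
      have "\<bar>d t\<bar> \<le> N * w t" using N(2)[of t] X0 t by (auto simp: w_def)
      also have "\<dots> \<le> N * w (X (j - 1))"
        using t A by (intro mult_left_mono N) (auto simp: w_def)
      finally show ?thesis .
    qed
    then have "\<bar>e s\<bar> \<le> g j + A * (N * w (X (j - 1)))" by (intro loc j) auto
    also have "\<dots> \<le> g j + A * (N * (2 * w s))"
      using A N w by (intro add_left_mono mult_left_mono) auto
    finally show ?thesis using False mesh_cell_eq[OF mesh(1) j] by (simp add: G_def mult_ac)
  qed
  have wint: "(w has_integral ((w x - 1) / (4 * A))) {x..b}"
  proof -
    have "(w has_integral (- w b / (4 * A) - (- w x / (4 * A)))) {x..b}"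
      unfolding w_def using x A
      by (intro fundamental_theorem_of_calculus)
         (auto intro!: derivative_eq_intros simp flip: has_real_derivative_iff_has_vector_derivative)
    then show ?thesis by (simp add: w_def diff_divide_distrib)
  qed
  have Gx: "G integrable_on {x..b}"
    using integrable_on_subinterval[OF has_integral_integrable[OF Gint], of x b] x by auto
  have ex: "e integrable_on {x..b}" using integrable_on_subinterval[OF e, of x b] x by auto
  have wx: "(\<lambda>s. 2 * A * N * w s) integrable_on {x..b}"
    using wint by (intro integrable_on_mult_right) auto
  have "norm (integral {x..b} e) \<le> integral {x..b} (\<lambda>s. G s + 2 * A * N * w s)"
    by (intro integral_norm_bound_integral ex integrable_add Gx wx bound)
  also have "\<dots> = integral {x..b} G + 2 * A * N * ((w x - 1) / (4 * A))"
    using wint by (subst integral_add[OF Gx wx]) (auto simp: integral_unique)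
  also have "integral {x..b} G \<le> integral {0..b} G"
    using x G0 Gint Gx by (intro integral_subset_le) auto
  also have "integral {0..b} G = (\<Sum>j=1..M. g j * (X j - X (j - 1)))"
    using Gint by (rule integral_unique)
  also have "2 * A * N * ((w x - 1) / (4 * A)) \<le> N / 2 * w x"
    using A N by (simp add: field_simps)
  finally show ?thesis by (simp add: w_def)
qed

text \<open>A discrete Gronwall inequality: with \<open>N\<close> the weighted norm of \<open>d\<close>, attained by compactness, the
  previous estimate reads \<open>N \<le> \<delta> + N / 2\<close>.\<close>
lemma volterra_stability:
  fixes X :: "nat \<Rightarrow> real" and d e :: "real \<Rightarrow> real"
  assumes mesh: "mono_on {..M} X" "X 0 = 0" "X M = b"
    and size: "\<And>j. j \<in> {1..M} \<Longrightarrow> X j - X (j - 1) \<le> H" and H: "exp (4 * A * H) \<le> 2"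
    and A: "0 < A"
    and e: "e integrable_on {0..b}"
    and d: "continuous_on {0..b} d" "\<And>x. x \<in> {0..b} \<Longrightarrow> \<bar>d x\<bar> \<le> \<bar>integral {x..b} e\<bar>"
    and g: "\<And>j. j \<in> {1..M} \<Longrightarrow> 0 \<le> g j"
    and loc: "\<And>j s B. \<lbrakk>j \<in> {1..M}; s \<in> {X (j - 1)<..X j}; 
                \<And>t. t \<in> {X (j - 1)..b} \<Longrightarrow> \<bar>d t\<bar> \<le> B\<rbrakk> \<Longrightarrow> \<bar>e s\<bar> \<le> g j + A * B"
    and x: "x \<in> {0..b}"
  shows "\<bar>d x\<bar> \<le> 2 * exp (4 * A * b) * (\<Sum>j=1..M. g j * (X j - X (j - 1)))"
proof -
  define w where "w s = exp (4 * A * (b - s))" for s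
  define \<delta> where "\<delta> = (\<Sum>j=1..M. g j * (X j - X (j - 1)))"
  have \<delta>: "0 \<le> \<delta>" unfolding \<delta>_def
    using mono_onD[OF mesh(1)] g by (intro sum_nonneg mult_nonneg_nonneg) auto
  have ne: "{0..b} \<noteq> {}" using x by auto
  have cont: "continuous_on {0..b} (\<lambda>s. \<bar>d s\<bar> / w s)"
    unfolding w_def by (intro continuous_intros d) auto
  then obtain s0 where s0: "s0 \<in> {0..b}" "\<And>s. s \<in> {0..b} \<Longrightarrow> \<bar>d s\<bar> / w s \<le> \<bar>d s0\<bar> / w s0"
    using continuous_attains_sup[OF compact_Icc ne cont] by blast
  define N where "N = \<bar>d s0\<bar> / w s0"
  have wpos: "0 < w s" for s by (simp add: w_def)
  have N: "0 \<le> N" using wpos[of s0] by (simp add: N_def)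
  have dN: "\<bar>d s\<bar> \<le> N * w s" if "s \<in> {0..b}" for s
    using s0(2)[OF that] wpos[of s] by (simp add: N_def[symmetric] pos_divide_le_eq)
  have bd: "\<bar>integral {s0..b} e\<bar> \<le> \<delta> + N / 2 * exp (4 * A * (b - s0))"
    unfolding \<delta>_def
    by (rule weighted_volterra_bound[OF mesh size H A e N dN[unfolded w_def] g loc s0(1)]) auto
  have w1: "1 \<le> w s0" using s0 A by (auto simp: w_def)
  have "N * w s0 = \<bar>d s0\<bar>" using wpos[of s0] by (simp add: N_def)
  also have "\<dots> \<le> \<delta> + N / 2 * w s0" using d(2)[OF s0(1)] bd by (simp add: w_def)
  finally have "N * w s0 \<le> 2 * \<delta>" by simp
  moreover have "N * 1 \<le> N * w s0" using N w1 by (intro mult_left_mono) auto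
  ultimately have N2: "N \<le> 2 * \<delta>" by simp
  have "\<bar>d x\<bar> \<le> N * w x" by (rule dN[OF x])
  also have "\<dots> \<le> (2 * \<delta>) * exp (4 * A * b)"
    using x A N2 \<delta> by (intro mult_mono) (auto simp: w_def)
  finally show ?thesis by (simp add: \<delta>_def mult_ac)
qed

section \<open>Power sums\<close>

text \<open>By the mean value theorem the increment is \<open>p * z powr (p - 1)\<close> with \<open>z\<close> between \<open>i\<close> and \<open>Suc i\<close>.
  For \<open>p < 1\<close> the power decreases, and \<open>z \<ge> Suc i / 2\<close> costs a factor of at most 2. Since \<open>i = 0\<close> is
  included, the estimate covers the cell that touches the singularity.\<close>
lemma powr_increment_le:
  fixes p :: real
  assumes "0 < p"
  shows "real (Suc i) powr p - real i powr p \<le> (1 + 2 * p) * real (Suc i) powr (p - 1)"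
proof (cases "i = 0")
  case True
  then show ?thesis using assms by simp
next
  case False
  have "\<exists>z. real i < z \<and> z < real (Suc i) \<and>
     real (Suc i) powr p - real i powr p = (real (Suc i) - real i) * (p * z powr (p - 1))"
    using False by (intro MVT2) (auto intro!: derivative_eq_intros)
  then obtain z where z: "real i < z" "z < real (Suc i)"
     "real (Suc i) powr p - real i powr p = p * z powr (p - 1)" by auto
  have "z powr (p - 1) \<le> 2 * real (Suc i) powr (p - 1)"
  proof (cases "p \<ge> 1")
    case True
    then have "z powr (p - 1) \<le> real (Suc i) powr (p - 1)" using z by (intro powr_mono2) auto
    also have "\<dots> \<le> 2 * \<dots>" by simp
    finally show ?thesis .
  next
    case p1: False
    have "z powr (p - 1) \<le> (real (Suc i) / 2) powr (p - 1)"
      using z p1 False by (intro powr_mono2') auto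
    also have "\<dots> = real (Suc i) powr (p - 1) * 2 powr (1 - p)"
      by (simp add: powr_divide powr_diff field_simps)
    also have "\<dots> \<le> real (Suc i) powr (p - 1) * 2 powr 1"
      using assms by (intro mult_left_mono powr_mono) auto
    finally show ?thesis by simp
  qed
  then have "p * z powr (p - 1) \<le> p * (2 * real (Suc i) powr (p - 1))"
    using assms by (intro mult_left_mono) auto
  also have "\<dots> \<le> (1 + 2 * p) * real (Suc i) powr (p - 1)"
    by (simp add: algebra_simps)
  finally show ?thesis using z by simp
qed

text \<open>For negative \<open>p\<close> each summand is at most \<open>1 / (p + 1)\<close> times an increment of \<open>x powr (p + 1)\<close>, so the
  sum telescopes.\<close>
lemma sum_powr_le_power:
  fixes p :: real
  assumes "-1 < p"
  obtains C where "\<And>M. (\<Sum>i<M. real (Suc i) powr p) \<le> C * real M powr (p + 1)" "0 \<le> C"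
proof (cases "p \<ge> 0")
  case True
  have "(\<Sum>i<M. real (Suc i) powr p) \<le> 1 * real M powr (p + 1)" for M
  proof -
    have "(\<Sum>i<M. real (Suc i) powr p) \<le> (\<Sum>i<M. real M powr p)"
      using True by (intro sum_mono powr_mono2) auto
    also have "\<dots> = real M powr (p + 1)" by (cases "M = 0") (auto simp: powr_add)
    finally show ?thesis by simp
  qed
  then show ?thesis using that[of 1] by auto
next
  case False
  have step: "(p + 1) * real (Suc i) powr p \<le> real (Suc i) powr (p + 1) - real i powr (p + 1)" for i
  proof (cases "i = 0")
    case True then show ?thesis using assms False by simp
  next
    case i: False
    have "\<exists>z. real i < z \<and> z < real (Suc i) \<and>
      real (Suc i) powr (p + 1) - real i powr (p + 1)
        = (real (Suc i) - real i) * ((p + 1) * z powr (p + 1 - 1))"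
      using i by (intro MVT2) (auto intro!: derivative_eq_intros)
    then obtain z where z: "real i < z" "z < real (Suc i)"
      "real (Suc i) powr (p + 1) - real i powr (p + 1) = (p + 1) * z powr p" by auto
    then show ?thesis using False assms i by (auto intro!: mult_left_mono powr_mono2')
  qed
  have "(\<Sum>i<M. real (Suc i) powr p) \<le> 1 / (p + 1) * real M powr (p + 1)" for M
  proof -
    have "(p + 1) * (\<Sum>i<M. real (Suc i) powr p) \<le> (\<Sum>i<M. real (Suc i) powr (p + 1) - real i powr (p + 1))"
      unfolding sum_distrib_left by (intro sum_mono step)
    also have "\<dots> = real M powr (p + 1)"
      using assms by (subst sum_lessThan_telescope) auto
    finally show ?thesis using assms by (simp add: field_simps)
  qed
  then show ?thesis using that[of "1 / (p + 1)"] assms by auto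
qed

text \<open>The three cases of a power sum (convergent, harmonic, divergent) are exactly the cases of
  \<open>varpi\<close>; this is where the logarithm for \<open>s = n\<close> comes from.\<close>
lemma sum_powr_le_varpi:
  fixes s n :: real
  obtains C where "\<And>M. 2 \<le> M \<Longrightarrow>
     (\<Sum>i<M. real (Suc i) powr (s - 1 - n)) \<le> C * (real M powr s * varpi s n M)" "0 \<le> C"
proof (cases s n rule: linorder_cases)
  case less
  have "summable (\<lambda>i. real (Suc i) powr (s - 1 - n))"
    using summable_real_powr_iff[of "s - 1 - n"] less
    by (subst summable_Suc_iff[of "\<lambda>i. real i powr (s - 1 - n)"]) auto
  then have "(\<Sum>i<M. real (Suc i) powr (s - 1 - n)) \<le> (\<Sum>i. real (Suc i) powr (s - 1 - n))" for M
    by (intro sum_le_suminf) auto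
  moreover have "real M powr s * varpi s n M = 1" if "2 \<le> M" for M :: nat
    using that less by (simp add: varpi_def powr_minus)
  ultimately show ?thesis
    using that[of "\<Sum>i. real (Suc i) powr (s - 1 - n)"] 
    by (metis \<open>summable (\<lambda>i. real (Suc i) powr (s - 1 - n))\<close> mult.right_neutral powr_ge_zero suminf_nonneg)
next
  case equal
  have main: "(\<Sum>i<M. real (Suc i) powr (s - 1 - n)) \<le> (1 + 1 / ln 2) * (real M powr s * varpi s n M)"
    if M: "2 \<le> M" for M
  proof -
    have "(\<Sum>i<M. real (Suc i) powr (s - 1 - n)) = harm M"
      using equal by (simp add: harm_altdef powr_minus)
    also have "\<dots> \<le> 1 + ln (real M)"
      using euler_mascheroni_sequence_decreasing[of 1 M] M by (simp add: harm_expand)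
    also have "1 \<le> ln (real M) / ln 2" using M by simp
    finally have "(\<Sum>i<M. real (Suc i) powr (s - 1 - n)) \<le> (1 + 1 / ln 2) * ln (real M)"
      by (simp add: algebra_simps)
    moreover have "real M powr s * varpi s n M = ln (real M)"
      using M equal by (simp add: varpi_def powr_minus)
    ultimately show ?thesis by simp
  qed
  show ?thesis by (rule that[OF main]) auto
next
  case greater
  obtain C where C: "\<And>M. (\<Sum>i<M. real (Suc i) powr (s - 1 - n)) \<le> C * real M powr (s - 1 - n + 1)" "0 \<le> C"
    using sum_powr_le_power[of "s - 1 - n"] greater by auto
  have "real M powr s * varpi s n M = real M powr (s - 1 - n + 1)" if "2 \<le> M" for M :: nat
    using that greater by (simp add: varpi_def powr_minus powr_diff field_simps)
  then show ?thesis using that[of C] C by metis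
qed

section \<open>The weakly singular right-hand side\<close>

lemma has_integral_weak_singularity:
  fixes \<nu> x b :: real
  assumes "0 < \<nu>" "x \<le> b"
  shows "((\<lambda>s. (s - x) powr (\<nu> - 1)) has_integral (b - x) powr \<nu> / \<nu>) {x..b}"
proof -
  have "((\<lambda>s. s powr (\<nu> - 1)) has_integral (b - x) powr (\<nu> - 1 + 1) / (\<nu> - 1 + 1)) {0..b - x}"
    by (intro has_integral_powr_from_0) (use assms in auto)
  then show ?thesis
    using has_integral_shift_Icc_real[of "\<lambda>s. (s - x) powr (\<nu> - 1)" x _ 0 "b - x"]
    by (simp add: o_def)
qed

lemma continuous_on_kernel_section:
  fixes K :: "real \<Rightarrow> real \<Rightarrow> real"
  assumes "continuous_on {(x, s). 0 \<le> x \<and> x \<le> s \<and> s \<le> b} (\<lambda>(x, s). K x s)" "0 \<le> x"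
  shows "continuous_on {x..b} (K x)"
proof -
  have "continuous_on {x..b} (\<lambda>s. (\<lambda>(x, s). K x s) (x, s))"
    by (rule continuous_on_compose2[OF assms(1)]) (use assms(2) in \<open>auto intro!: continuous_intros\<close>)
  then show ?thesis by simp
qed

lemma integrable_weakly_singular:
  fixes \<nu> x b :: real and f :: "real \<Rightarrow> real"
  assumes "0 < \<nu>" "x \<le> b" "continuous_on {x..b} f"
  shows "(\<lambda>s. (s - x) powr (\<nu> - 1) * f s) integrable_on {x..b}"
proof -
  have "(\<lambda>s. (s - x) powr (\<nu> - 1)) integrable_on {x..b}"
    using has_integral_weak_singularity[OF assms(1,2)] by blast
  then have "(\<lambda>s. (s - x) powr (\<nu> - 1)) absolutely_integrable_on {x..b}"
    by (rule nonnegative_absolutely_integrable_1) auto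
  moreover have "bounded (f ` {x..b})"
    using assms(3) by (intro compact_imp_bounded compact_continuous_image) auto
  moreover have "f \<in> borel_measurable (lebesgue_on {x..b})"
    using assms(3) by (intro continuous_imp_measurable_on_sets_lebesgue) auto
  ultimately have "(\<lambda>s. f s * (s - x) powr (\<nu> - 1)) absolutely_integrable_on {x..b}"
    by (intro absolutely_integrable_bounded_measurable_product_real) auto
  then show ?thesis
    by (simp add: mult.commute absolutely_integrable_on_def)
qed

text \<open>The kernel \<open>(s - x) powr (\<nu> - 1)\<close> is integrable and \<open>a\<close>, \<open>K\<close> are bounded by compactness. The right-hand
  side at \<open>x\<close> depends only on the values on \<open>{x..b}\<close>, which makes the problem one of Volterra type
  running backwards from \<open>b\<close>.\<close>
lemma avide_rhs_lipschitz:
  assumes "0 < \<nu>" and "continuous_on {0..b} a"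
    and K: "continuous_on {(x, s). 0 \<le> x \<and> x \<le> s \<and> s \<le> b} (\<lambda>(x, s). K x s)"
  obtains A where "0 < A"
    and "\<And>x f g B. \<lbrakk>x \<in> {0..b}; continuous_on {x..b} f; continuous_on {x..b} g;
           \<And>t. t \<in> {x..b} \<Longrightarrow> \<bar>f t - g t\<bar> \<le> B\<rbrakk>
         \<Longrightarrow> \<bar>avide_rhs b \<nu> a chi K f x - avide_rhs b \<nu> a chi K g x\<bar> \<le> A * B"
proof -
  let ?D = "{(x, s). 0 \<le> x \<and> x \<le> s \<and> s \<le> b}"
  have "?D = ({0..b} \<times> {0..b}) \<inter> {p. fst p \<le> snd p}" by auto
  moreover have "closed {p :: real \<times> real. fst p \<le> snd p}"
    by (intro closed_Collect_le continuous_intros)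
  ultimately have D: "compact ?D" by (simp add: compact_Int_closed compact_Times)
  then have "bounded ((\<lambda>(x, s). K x s) ` ?D)"
    using K by (intro compact_imp_bounded compact_continuous_image)
  then obtain \<kappa> where \<kappa>: "0 < \<kappa>" "\<And>x s. \<lbrakk>0 \<le> x; x \<le> s; s \<le> b\<rbrakk> \<Longrightarrow> \<bar>K x s\<bar> \<le> \<kappa>"
    unfolding bounded_pos by fastforce
  have "bounded (a ` {0..b})"
    using assms(2) by (intro compact_imp_bounded compact_continuous_image) auto
  then obtain \<alpha> where \<alpha>: "0 < \<alpha>" "\<And>x. x \<in> {0..b} \<Longrightarrow> \<bar>a x\<bar> \<le> \<alpha>"
    unfolding bounded_pos by fastforce
  define A where "A = \<alpha> + \<kappa> * (b powr \<nu> / \<nu>)"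
  have "\<bar>avide_rhs b \<nu> a chi K f x - avide_rhs b \<nu> a chi K g x\<bar> \<le> A * B"
    if x: "x \<in> {0..b}" and f: "continuous_on {x..b} f" and g: "continuous_on {x..b} g"
      and B: "\<And>t. t \<in> {x..b} \<Longrightarrow> \<bar>f t - g t\<bar> \<le> B" for x f g B
  proof -
    have x': "0 \<le> x" "x \<le> b" using x by auto
    note cK = continuous_on_kernel_section[OF K x'(1)]
    have B0: "0 \<le> B" using B[of x] x by auto
    have int: "(\<lambda>s. (s - x) powr (\<nu> - 1) * K x s * h s) integrable_on {x..b}"
      if "continuous_on {x..b} h" for h
      using integrable_weakly_singular[OF assms(1) x'(2), of "\<lambda>s. K x s * h s"] that cK
      by (simp add: mult.assoc continuous_on_mult)
    have "norm (integral {x..b} (\<lambda>s. (s - x) powr (\<nu> - 1) * K x s * (f s - g s)))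
        \<le> integral {x..b} (\<lambda>s. (\<kappa> * B) * (s - x) powr (\<nu> - 1))"
    proof (intro integral_norm_bound_integral int continuous_intros f g)
      show "(\<lambda>s. (\<kappa> * B) * (s - x) powr (\<nu> - 1)) integrable_on {x..b}"
        using has_integral_weak_singularity[OF assms(1) x'(2)] by (intro integrable_on_mult_right) auto
      fix s assume s: "s \<in> {x..b}"
      have "\<bar>K x s\<bar> * \<bar>f s - g s\<bar> \<le> \<kappa> * B"
        using \<kappa> B s x' by (intro mult_mono) auto
      then show "norm ((s - x) powr (\<nu> - 1) * K x s * (f s - g s)) \<le> (\<kappa> * B) * (s - x) powr (\<nu> - 1)"
        by (simp add: abs_mult mult.assoc mult.commute[of _ "(s - x) powr (\<nu> - 1)"] mult_left_mono)
    qed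
    also have "\<dots> = (\<kappa> * B) * ((b - x) powr \<nu> / \<nu>)"
      using has_integral_weak_singularity[OF assms(1) x'(2)] by (simp add: integral_unique)
    also have "\<dots> \<le> (\<kappa> * B) * (b powr \<nu> / \<nu>)"
      using \<kappa> B0 x' assms(1) by (intro mult_left_mono divide_right_mono powr_mono2) auto
    finally have 1: "\<bar>integral {x..b} (\<lambda>s. (s - x) powr (\<nu> - 1) * K x s * (f s - g s))\<bar>
        \<le> \<kappa> * (b powr \<nu> / \<nu>) * B" by (simp add: mult_ac)
    have 2: "\<bar>a x * (f x - g x)\<bar> \<le> \<alpha> * B"
      unfolding abs_mult using \<alpha> B x by (intro mult_mono) auto
    have "avide_rhs b \<nu> a chi K f x - avide_rhs b \<nu> a chi K g x = a x * (f x - g x)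
       + integral {x..b} (\<lambda>s. (s - x) powr (\<nu> - 1) * K x s * (f s - g s))"
      by (simp add: avide_rhs_def right_diff_distrib integral_diff int f g)
    then show ?thesis using 1 2 by (simp add: A_def algebra_simps abs_le_iff)
  qed
  moreover have "0 < A" unfolding A_def using \<alpha> \<kappa> assms(1) by (intro add_pos_nonneg) auto
  ultimately show ?thesis using that by blast
qed

section \<open>The graded mesh and the fractional Lagrange basis\<close>

lemma node_0 [simp]: "0 < M \<Longrightarrow> node b q M 0 = 0"
  by (simp add: node_def)

lemma node_last [simp]: "node b q M M = b"
  by (simp add: node_def)

lemma diff_node: "b - node b q M j = b * ((real M - real j) / real M) powr q"
  by (simp add: node_def algebra_simps)

lemma node_strict_mono:
  assumes "0 < b" "0 < q" "i < j" "j \<le> M"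
  shows "node b q M i < node b q M j"
proof -
  have "((real M - real j) / real M) powr q < ((real M - real i) / real M) powr q"
    using assms by (intro powr_less_mono2) (auto intro: divide_strict_right_mono)
  then show ?thesis using assms by (simp add: node_def)
qed

lemma mono_node:
  assumes "0 < b" "0 < q"
  shows "mono_on {..M} (node b q M)"
proof (rule mono_onI)
  fix i j assume "i \<in> {..M}" "j \<in> {..M}" "i \<le> j"
  then show "node b q M i \<le> node b q M j"
    using node_strict_mono[OF assms, of i j M] by (cases "i = j") auto
qed

lemma node_in:
  assumes "0 < b" "0 < q" "0 < M" "j \<le> M"
  shows "node b q M j \<in> {0..b}"
  using mono_onD[OF mono_node[OF assms(1,2), of M], of 0 j]
    mono_onD[OF mono_node[OF assms(1,2), of M], of j M] assms by simp

lemma node_step: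
  assumes "j \<in> {1..M}"
  shows "node b q M j - node b q M (j - 1)
     = b * real M powr (- q) * (real (Suc (M - j)) powr q - real (M - j) powr q)"
proof -
  have 1: "real M - real j = real (M - j)" "real M - real (j - 1) = real (Suc (M - j))"
    using assms by (auto simp: of_nat_diff)
  have "node b q M j - node b q M (j - 1) = (b - node b q M (j - 1)) - (b - node b q M j)" by simp
  also have "\<dots> = b * real M powr (- q) * (real (Suc (M - j)) powr q - real (M - j) powr q)"
    unfolding diff_node 1
    by (simp add: powr_divide powr_minus_divide diff_divide_distrib right_diff_distrib)
  finally show ?thesis .
qed

lemma node_step_le:
  assumes "0 < b" "0 < q" "j \<in> {1..M}"
  shows "node b q M j - node b q M (j - 1)
     \<le> b * (1 + 2 * q) * real M powr (- q) * real (Suc (M - j)) powr (q - 1)"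
proof -
  have "b * real M powr (- q) * (real (Suc (M - j)) powr q - real (M - j) powr q)
     \<le> b * real M powr (- q) * ((1 + 2 * q) * real (Suc (M - j)) powr (q - 1))"
    using assms by (intro mult_left_mono powr_increment_le) auto
  then show ?thesis unfolding node_step[OF assms(3)] by (simp only: mult_ac)
qed

lemma diff_rho_node:
  assumes "0 < b" "j \<le> M"
  shows "b - rho_node b \<mu> q M j = b powr \<mu> * (real (M - j) / real M) powr (q * \<mu>)"
  using assms
  by (simp add: rho_node_def diff_node powr_mult powr_powr of_nat_diff)

lemma rho_step_eq:
  assumes "0 < b" "j \<in> {1..M}"
  shows "rho_step b \<mu> q M j = b powr \<mu> * real M powr (- (q * \<mu>))
     * (real (Suc (M - j)) powr (q * \<mu>) - real (M - j) powr (q * \<mu>))"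
proof -
  have 1: "M - (j - 1) = Suc (M - j)" using assms by auto
  have "rho_step b \<mu> q M j = (b - rho_node b \<mu> q M (j - 1)) - (b - rho_node b \<mu> q M j)"
    by (simp add: rho_step_def)
  also have "\<dots> = b powr \<mu> * (real (Suc (M - j)) / real M) powr (q * \<mu>)
                  - b powr \<mu> * (real (M - j) / real M) powr (q * \<mu>)"
    by (subst (1 2) diff_rho_node) (use assms 1 in auto)
  finally show ?thesis
    by (simp add: powr_divide powr_minus_divide diff_divide_distrib right_diff_distrib)
qed

lemma rho_step_pos:
  assumes "0 < b" "0 < q" "0 < \<mu>" "j \<in> {1..M}"
  shows "0 < rho_step b \<mu> q M j"
  unfolding rho_step_eq[OF assms(1,4)] using assms
  by (intro mult_pos_pos) (auto intro!: powr_less_mono2)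

lemma rho_step_le:
  assumes "0 < b" "0 < q" "0 < \<mu>" "j \<in> {1..M}"
  shows "rho_step b \<mu> q M j \<le> b powr \<mu> * (1 + 2 * (q * \<mu>)) * real M powr (- (q * \<mu>))
           * real (Suc (M - j)) powr (q * \<mu> - 1)"
proof -
  have "b powr \<mu> * real M powr (- (q * \<mu>))
     * (real (Suc (M - j)) powr (q * \<mu>) - real (M - j) powr (q * \<mu>))
    \<le> b powr \<mu> * real M powr (- (q * \<mu>)) * ((1 + 2 * (q * \<mu>)) * real (Suc (M - j)) powr (q * \<mu> - 1))"
    using assms by (intro mult_left_mono powr_increment_le) auto
  then show ?thesis unfolding rho_step_eq[OF assms(1,4)] by (simp only: mult_ac)
qed

lemma rho_node_split:
  "rho_node b \<mu> q M j = rho_node b \<mu> q M (j - 1) + rho_step b \<mu> q M j"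
  by (simp add: rho_step_def)

text \<open>Reference coordinates: \<open>\<theta> \<mapsto> cell_point\<close> maps the unit interval affinely onto the \<open>j\<close>-th cell in
  the variable \<open>\<rho>\<close>, and \<open>cell_coord\<close> expresses a point \<open>x\<close> of the \<open>j\<close>-th cell in this coordinate.\<close>
definition cell_point :: "real \<Rightarrow> real \<Rightarrow> real \<Rightarrow> nat \<Rightarrow> nat \<Rightarrow> real \<Rightarrow> real" where
  "cell_point b \<mu> q M j \<theta> = rho_node b \<mu> q M (j - 1) + \<theta> * rho_step b \<mu> q M j"

definition cell_coord :: "real \<Rightarrow> real \<Rightarrow> real \<Rightarrow> nat \<Rightarrow> nat \<Rightarrow> real \<Rightarrow> real" where
  "cell_coord b \<mu> q M j x
     = (b - (b - x) powr \<mu> - rho_node b \<mu> q M (j - 1)) / rho_step b \<mu> q M j"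

lemma colloc_pt_eq: "colloc_pt b \<mu> q \<xi> M j l = tau b \<mu> (cell_point b \<mu> q M j (\<xi> l))"
  by (simp add: colloc_pt_def cell_point_def)

lemma cell_point_bounds:
  assumes "0 < b" "0 < q" "0 < \<mu>" "j \<in> {1..M}" "\<theta> \<in> {0..1}"
  shows "rho_node b \<mu> q M (j - 1) \<le> cell_point b \<mu> q M j \<theta>"
    "cell_point b \<mu> q M j \<theta> \<le> rho_node b \<mu> q M j"
    "cell_point b \<mu> q M j \<theta> \<in> {b - b powr \<mu>..b}"
proof -
  have s: "0 < rho_step b \<mu> q M j" by (intro rho_step_pos assms)
  show 1: "rho_node b \<mu> q M (j - 1) \<le> cell_point b \<mu> q M j \<theta>"
    using s assms by (simp add: cell_point_def)
  show 2: "cell_point b \<mu> q M j \<theta> \<le> rho_node b \<mu> q M j"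
    using s assms rho_node_split[of b \<mu> q M j]
    by (simp add: cell_point_def mult_left_le_one_le)
  have "rho_node b \<mu> q M j \<le> b" by (simp add: rho_node_def)
  moreover have "b - b powr \<mu> \<le> rho_node b \<mu> q M (j - 1)"
  proof -
    have "node b q M (j - 1) \<in> {0..b}" using assms by (intro node_in) auto
    then show ?thesis using assms by (simp add: rho_node_def powr_mono2)
  qed
  ultimately show "cell_point b \<mu> q M j \<theta> \<in> {b - b powr \<mu>..b}" using 1 2 by auto
qed

lemma tau_cell_point_powr:
  assumes "0 < b" "0 < q" "0 < \<mu>" "j \<in> {1..M}" "\<theta> \<in> {0..1}"
  shows "(b - tau b \<mu> (cell_point b \<mu> q M j \<theta>)) powr \<mu> = b - cell_point b \<mu> q M j \<theta>"
  using cell_point_bounds(3)[OF assms] assms by (simp add: tau_def powr_powr)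

lemma tau_rho:
  assumes "0 < \<mu>" "x \<le> b"
  shows "tau b \<mu> (b - (b - x) powr \<mu>) = x"
  using assms by (simp add: tau_def powr_powr)

lemma tau_mono:
  assumes "0 < \<mu>" "\<rho> \<le> \<rho>'" "\<rho>' \<le> b"
  shows "tau b \<mu> \<rho> \<le> tau b \<mu> \<rho>'"
  using assms by (simp add: tau_def powr_mono2)

lemma tau_rho_node:
  assumes "0 < b" "0 < q" "0 < \<mu>" "0 < M" "j \<le> M"
  shows "tau b \<mu> (rho_node b \<mu> q M j) = node b q M j"
  unfolding rho_node_def using assms node_in[OF assms(1,2,4,5)] by (intro tau_rho) auto

lemma tau_cell_point_in:
  assumes "0 < b" "0 < q" "0 < \<mu>" "j \<in> {1..M}" "\<theta> \<in> {0..1}"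
  shows "tau b \<mu> (cell_point b \<mu> q M j \<theta>) \<in> {node b q M (j - 1)..node b q M j}"
proof -
  note c = cell_point_bounds[OF assms]
  have "rho_node b \<mu> q M j \<le> b" by (simp add: rho_node_def)
  then show ?thesis
    using tau_mono[OF assms(3) c(1), of b] tau_mono[OF assms(3) c(2), of b] c(3) assms
      tau_rho_node[of b q \<mu> M j] tau_rho_node[of b q \<mu> M "j - 1"] by auto
qed

lemma cell_coord_in:
  assumes "0 < b" "0 < q" "0 < \<mu>" "j \<in> {1..M}" "x \<in> {node b q M (j - 1)..node b q M j}"
  shows "cell_coord b \<mu> q M j x \<in> {0..1}"
    "tau b \<mu> (cell_point b \<mu> q M j (cell_coord b \<mu> q M j x)) = x"
proof -
  have s: "0 < rho_step b \<mu> q M j" by (intro rho_step_pos assms)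
  have jM: "node b q M j \<le> b" using node_in[of b q M j] assms by auto
  have "(b - node b q M j) powr \<mu> \<le> (b - x) powr \<mu>"
    using assms jM by (intro powr_mono2) auto
  moreover have "(b - x) powr \<mu> \<le> (b - node b q M (j - 1)) powr \<mu>"
    using assms jM by (intro powr_mono2) auto
  ultimately show "cell_coord b \<mu> q M j x \<in> {0..1}"
    using s by (simp add: cell_coord_def rho_step_def rho_node_def divide_simps)
  have "cell_point b \<mu> q M j (cell_coord b \<mu> q M j x) = b - (b - x) powr \<mu>"
    using s by (simp add: cell_point_def cell_coord_def)
  then show "tau b \<mu> (cell_point b \<mu> q M j (cell_coord b \<mu> q M j x)) = x"
    using tau_rho[OF assms(3), of x b] jM assms by simp
qed

text \<open>In the variable \<open>\<rho>\<close> the fractional basis is an ordinary polynomial basis, and after rescaling to the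
  unit interval it is the same on all cells and all meshes.\<close>
lemma frac_lagrange_eq_lagrange_basis:
  assumes "0 < b" "0 < q" "0 < \<mu>" "j \<in> {1..M}" "\<xi> ` {1..n} \<subseteq> {0..1}" "l \<in> {1..n}"
  shows "frac_lagrange b \<mu> q n \<xi> M j l x
     = lagrange_basis \<xi> {1..n} l (cell_coord b \<mu> q M j x)"
  unfolding frac_lagrange_def lagrange_basis_def
proof (rule prod.cong)
  fix i assume i: "i \<in> {1..n} - {l}"
  have s: "0 < rho_step b \<mu> q M j" by (intro rho_step_pos assms)
  have \<xi>: "\<xi> k \<in> {0..1}" if "k \<in> {1..n}" for k using assms(5) that by blast
  have c: "(b - colloc_pt b \<mu> q \<xi> M j k) powr \<mu> = b - cell_point b \<mu> q M j (\<xi> k)"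
    if "k \<in> {1..n}" for k
    unfolding colloc_pt_eq by (intro tau_cell_point_powr assms \<xi> that)
  have num: "(b - x) powr \<mu> - (b - colloc_pt b \<mu> q \<xi> M j i) powr \<mu>
      = - rho_step b \<mu> q M j * (cell_coord b \<mu> q M j x - \<xi> i)"
  proof -
    have "rho_step b \<mu> q M j * cell_coord b \<mu> q M j x
        = b - (b - x) powr \<mu> - rho_node b \<mu> q M (j - 1)"
      using s by (simp add: cell_coord_def)
    then show ?thesis using c[of i] i by (simp add: cell_point_def algebra_simps)
  qed
  have den: "(b - colloc_pt b \<mu> q \<xi> M j l) powr \<mu> - (b - colloc_pt b \<mu> q \<xi> M j i) powr \<mu>
      = - rho_step b \<mu> q M j * (\<xi> l - \<xi> i)"
    using c[of i] c[of l] assms(6) i by (simp add: cell_point_def algebra_simps)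
  show "((b - x) powr \<mu> - (b - colloc_pt b \<mu> q \<xi> M j i) powr \<mu>) /
         ((b - colloc_pt b \<mu> q \<xi> M j l) powr \<mu> - (b - colloc_pt b \<mu> q \<xi> M j i) powr \<mu>) =
         (cell_coord b \<mu> q M j x - \<xi> i) / (\<xi> l - \<xi> i)"
    unfolding num den using s by simp
qed simp

lemma continuous_on_frac_lagrange:
  assumes "0 < \<mu>" "S \<subseteq> {..b}"
  shows "continuous_on S (frac_lagrange b \<mu> q n \<xi> M j l)"
proof -
  have "continuous_on S (\<lambda>x. (b - x) powr \<mu>)"
    using assms by (intro continuous_on_powr' continuous_intros) auto
  then show ?thesis
    unfolding frac_lagrange_def divide_inverse
    by (intro continuous_on_prod continuous_on_mult continuous_on_diff continuous_on_const)
qed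

section \<open>Taylor approximation near the singularity\<close>

text \<open>Only the highest derivative enters, through the integral form of the remainder, and only to the
  right of the base point \<open>\<alpha>\<close>. Expanding at the left end of a cell therefore tolerates a
  singularity at its right end.\<close>
lemma taylor_remainder_le:
  fixes D :: "nat \<Rightarrow> real \<Rightarrow> real"
  assumes "0 < n" "\<alpha> \<le> \<rho>"
    and "\<And>k t. \<lbrakk>k < n; t \<in> {\<alpha>..\<rho>}\<rbrakk> \<Longrightarrow>
           (D k has_real_derivative D (Suc k) t) (at t within {\<alpha>..\<rho>})"
    and w: "\<And>t. t \<in> {\<alpha>..\<rho>} \<Longrightarrow> (\<rho> - t) ^ (n - 1) * \<bar>D n t\<bar> \<le> w t"
    and J: "(w has_integral J) {\<alpha>..\<rho>}"
  shows "\<bar>D 0 \<rho> - (\<Sum>k<n. D k \<alpha> / fact k * (\<rho> - \<alpha>) ^ k)\<bar> \<le> J"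
proof -
  have "((\<lambda>t. ((\<rho> - t) ^ (n - 1) / fact (n - 1)) *\<^sub>R D n t) has_integral
      D 0 \<rho> - (\<Sum>k<n. ((\<rho> - \<alpha>) ^ k / fact k) *\<^sub>R D k \<alpha>)) {\<alpha>..\<rho>}"
    by (rule Taylor_has_integral)
       (use assms in \<open>auto simp flip: has_real_derivative_iff_has_vector_derivative\<close>)
  moreover have "norm (((\<rho> - t) ^ (n - 1) / fact (n - 1)) *\<^sub>R D n t) \<le> w t" if "t \<in> {\<alpha>..\<rho>}" for t
  proof -
    have "norm (((\<rho> - t) ^ (n - 1) / fact (n - 1)) *\<^sub>R D n t)
        = ((\<rho> - t) ^ (n - 1) * \<bar>D n t\<bar>) / fact (n - 1)"
      using that by (simp add: abs_mult)
    also have "\<dots> \<le> ((\<rho> - t) ^ (n - 1) * \<bar>D n t\<bar>) / 1"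
      using that by (intro divide_left_mono mult_nonneg_nonneg) auto
    finally show ?thesis using w[OF that] by simp
  qed
  ultimately have "norm (D 0 \<rho> - (\<Sum>k<n. ((\<rho> - \<alpha>) ^ k / fact k) *\<^sub>R D k \<alpha>)) \<le> J"
    using integral_norm_bound_integral[of "\<lambda>t. ((\<rho> - t) ^ (n - 1) / fact (n - 1)) *\<^sub>R D n t" "{\<alpha>..\<rho>}" w] J
    by (simp only: has_integral_integrable_integral)
  then show ?thesis by (simp add: mult.commute)
qed

text \<open>The logarithm which the regularity class produces at the critical exponent \<open>\<gamma> = n\<close>.\<close>
definition log_factor :: "nat \<Rightarrow> real \<Rightarrow> nat \<Rightarrow> real" where
  "log_factor n \<gamma> M = (if real n = \<gamma> then ln (real M) else 1)"

lemma rho_step_power_le: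
  assumes "0 < b" "0 < q" "0 < \<mu>" "j \<in> {1..M}"
  shows "rho_step b \<mu> q M j ^ n \<le> (b powr \<mu> * (1 + 2 * (q * \<mu>))) ^ n
      * real M powr (- (q * \<mu> * n)) * real (Suc (M - j)) powr (q * \<mu> * n - n)"
proof -
  have "rho_step b \<mu> q M j ^ n \<le> (b powr \<mu> * (1 + 2 * (q * \<mu>)) * real M powr (- (q * \<mu>))
           * real (Suc (M - j)) powr (q * \<mu> - 1)) ^ n"
    using rho_step_pos[OF assms] by (intro power_mono rho_step_le assms) auto
  also have "\<dots> = (b powr \<mu> * (1 + 2 * (q * \<mu>))) ^ n
      * real M powr (- (q * \<mu> * n)) * real (Suc (M - j)) powr (q * \<mu> * n - n)"
  proof -
    have "real n * (q * \<mu> - 1) = q * \<mu> * n - n" "real n * - (q * \<mu>) = - (q * \<mu> * n)"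
      by (simp_all add: algebra_simps)
    then show ?thesis
      using assms by (simp only: power_mult_distrib powr_power) (simp add: powr_power mult_ac)
  qed
  finally show ?thesis .
qed

text \<open>Up to constant factors \<open>t\<close> lies between \<open>M powr (- r)\<close> and 1, so its logarithm is of order \<open>ln M\<close>;
  the additive 2 is absorbed into \<open>ln M\<close> because \<open>M \<ge> 2\<close>.\<close>
lemma abs_ln_cell_le:
  assumes "0 < b" "0 < r" "1 \<le> k" "k \<le> M" "0 < \<mu>" "2 \<le> M"
    and t: "b powr \<mu> * (real k / real M) powr r \<le> t" "t \<le> b powr \<mu>"
  shows "2 + \<bar>ln t\<bar> \<le> ((2 + \<mu> * \<bar>ln b\<bar>) / ln 2 + r) * ln (real M)"
proof -
  have pos: "0 < b powr \<mu> * (real k / real M) powr r" using assms by simp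
  have "0 < t" using pos t by linarith
  then have "ln t \<le> ln (b powr \<mu>)" using t assms by (subst ln_le_cancel_iff) auto
  moreover have "ln (b powr \<mu>) = \<mu> * ln b" using assms by (simp add: ln_powr)
  moreover have "ln (b powr \<mu> * (real k / real M) powr r) \<le> ln t"
    using t pos \<open>0 < t\<close> by (subst ln_le_cancel_iff) auto
  moreover have "ln (b powr \<mu> * (real k / real M) powr r) = \<mu> * ln b + r * (ln (real k) - ln (real M))"
    using assms by (simp add: ln_mult ln_powr ln_div)
  moreover have "0 \<le> r * ln (real k)" "0 \<le> r * ln (real M)" using assms by auto
  moreover have "\<mu> * ln b \<le> \<mu> * \<bar>ln b\<bar>" "\<mu> * (- ln b) \<le> \<mu> * \<bar>ln b\<bar>"
    using assms mult_left_mono[of "ln b" "\<bar>ln b\<bar>" \<mu>] mult_left_mono[of "- ln b" "\<bar>ln b\<bar>" \<mu>] by auto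
  ultimately have "\<bar>ln t\<bar> \<le> \<mu> * \<bar>ln b\<bar> + r * ln (real M)"
    unfolding right_diff_distrib mult_minus_right by (intro abs_leI) linarith+
  then have "2 + \<bar>ln t\<bar> \<le> (2 + \<mu> * \<bar>ln b\<bar>) * 1 + r * ln (real M)" by simp
  also have "\<dots> \<le> (2 + \<mu> * \<bar>ln b\<bar>) * (ln (real M) / ln 2) + r * ln (real M)"
    using assms by (intro add_right_mono mult_left_mono) auto
  finally show ?thesis unfolding distrib_right[of _ r] by simp
qed

text \<open>The logarithm near the singularity is harmless: \<open>\<bar>ln t\<bar> \<le> \<bar>ln h\<bar> + h / t\<close>, and the factor
  \<open>t ^ (n - 1)\<close> with \<open>n \<ge> 2\<close> cancels the denominator.\<close>
lemma power_times_ln_le: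
  fixes t h :: real
  assumes "0 < t" "t \<le> h" "2 \<le> n"
  shows "t ^ (n - 1) * (1 + \<bar>ln t\<bar>) \<le> h ^ (n - 1) * (2 + \<bar>ln h\<bar>)"
proof -
  have "ln (h / t) \<le> h / t" using ln_le_minus_one[of "h / t"] assms by simp
  moreover have "ln (h / t) = ln h - ln t" "0 \<le> h / t" "ln t \<le> ln h" 
    using assms by (simp_all add: ln_div)
  ultimately have lnt: "\<bar>ln t\<bar> \<le> \<bar>ln h\<bar> + h / t" by linarith
  have pw: "t ^ (n - 1) = t * t ^ (n - 2)" "h ^ (n - 1) = h * h ^ (n - 2)"
  proof -
    obtain m where "n = Suc (Suc m)" using assms(3) by (metis add_2_eq_Suc le_Suc_ex)
    then show "t ^ (n - 1) = t * t ^ (n - 2)" "h ^ (n - 1) = h * h ^ (n - 2)" by simp_all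
  qed
  have le: "t ^ (n - 1) \<le> h ^ (n - 1)" "t ^ (n - 2) \<le> h ^ (n - 2)" using assms by (auto intro: power_mono)
  have "t ^ (n - 1) * (1 + \<bar>ln t\<bar>) \<le> t ^ (n - 1) * (1 + (\<bar>ln h\<bar> + h / t))"
    using lnt assms by (intro mult_left_mono) auto
  also have "\<dots> = t ^ (n - 1) * (1 + \<bar>ln h\<bar>) + h * t ^ (n - 2)"
    using assms pw by (simp add: field_simps)
  also have "\<dots> \<le> h ^ (n - 1) * (1 + \<bar>ln h\<bar>) + h * h ^ (n - 2)"
    using assms le by (intro add_mono mult_right_mono mult_left_mono) auto
  finally show ?thesis using pw by (simp add: algebra_simps)
qed

text \<open>The local approximation order. Write \<open>r = q * \<mu>\<close> and \<open>i = M - j\<close>. In the variable \<open>\<rho>\<close> the \<open>j\<close>-th cell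
  has distance of order \<open>(i / M) powr r\<close> from the singularity \<open>\<rho> = b\<close> and length \<open>h\<close> of order
  \<open>M powr (- r) * Suc i powr (r - 1)\<close>. The Taylor remainder is at most \<open>h ^ n\<close> times the supremum of the
  \<open>n\<close>-th derivative, and inserting the growth bound of the regularity class gives the stated order.
  On the last cell, \<open>i = 0\<close>, the derivative may be unbounded; there the weight in the remainder
  is dominated by a power of the distance to the singularity, which is integrable.\<close>
lemma taylor_cell_bound:
  fixes f :: "real \<Rightarrow> real"
  assumes b: "0 < b" and q: "0 < q" and \<mu>: "0 < \<mu>" and \<gamma>: "0 < \<gamma>" and n: "2 \<le> n"
    and f: "f \<in> weighted_C n \<gamma> b \<mu>"
  obtains C where "0 \<le> C" and "\<And>M j. \<lbrakk>2 \<le> M; j \<in> {1..M}\<rbrakk> \<Longrightarrow>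
     \<exists>c. \<forall>\<theta>\<in>{0..1}. \<bar>f (cell_point b \<mu> q M j \<theta>) - (\<Sum>k<n. c k * \<theta> ^ k)\<bar>
       \<le> C * log_factor n \<gamma> M * real M powr (- (q * \<mu> * min n \<gamma>))
           * real (Suc (M - j)) powr (q * \<mu> * min n \<gamma> - n)"
proof -
  define W where "W k \<rho> c = (if real k < \<gamma> then c
                       else if real k = \<gamma> then c * (1 + \<bar>ln (b - \<rho>)\<bar>)
                       else c * (b - \<rho>) powr (\<gamma> - real k))" for k :: nat and \<rho> c
  obtain D :: "nat \<Rightarrow> real \<Rightarrow> real" and c :: "nat \<Rightarrow> real" where
    D0: "\<forall>\<rho>\<in>{b - b powr \<mu>..<b}. D 0 \<rho> = f \<rho>"
    and deriv: "\<forall>k<n. \<forall>\<rho>\<in>{b - b powr \<mu>..<b}.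
       (D k has_real_derivative D (Suc k) \<rho>) (at \<rho> within {b - b powr \<mu>..<b})"
    and DW: "\<forall>k\<le>n. \<forall>\<rho>\<in>{b - b powr \<mu>..<b}. \<bar>D k \<rho>\<bar> \<le> W k \<rho> (c k)"
    using f unfolding weighted_C_def W_def[symmetric] by blast
  have contf: "continuous_on {b - b powr \<mu>..b} f"
    using f unfolding weighted_C_def by blast
  have Dn: "\<bar>D n \<rho>\<bar> \<le> W n \<rho> (c n)" if "\<rho> \<in> {b - b powr \<mu>..<b}" for \<rho>
    using DW that by blast
  have cn: "0 \<le> c n"
  proof -
    have in_dom: "b - b powr \<mu> \<in> {b - b powr \<mu>..<b}" using b by simp
    have "0 < 1 + \<bar>ln (b powr \<mu>)\<bar>" "0 < (b powr \<mu>) powr (\<gamma> - real n)"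
      using b by (auto intro: add_pos_nonneg)
    then show ?thesis
      using order_trans[OF abs_ge_zero Dn[OF in_dom]]
      by (auto simp: zero_le_mult_iff W_def split: if_splits)
  qed
  define r where "r = q * \<mu>"
  have r: "0 < r" using q \<mu> by (simp add: r_def)
  define ch where "ch = (b powr \<mu> * (1 + 2 * r)) ^ n"
  have ch: "0 \<le> ch" using r by (simp add: ch_def)
  define cl where "cl = (2 + \<mu> * \<bar>ln b\<bar>) / ln 2 + r"
  have cl: "0 \<le> cl" using r \<mu> by (simp add: cl_def)
  define C where "C = (if real n < \<gamma> then c n * ch else if real n = \<gamma> then c n * cl * ch
      else c n * (ch * (b powr \<mu> * (1 / 2) powr r) powr (\<gamma> - n) + (b powr \<mu>) powr \<gamma> / \<gamma>))"
  have C: "0 \<le> C" using cn ch cl \<gamma> by (simp add: C_def)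
  define E where "E M i = C * log_factor n \<gamma> M * real M powr (- (r * min n \<gamma>))
           * real (Suc i) powr (r * min n \<gamma> - n)" for M i
  have main: "\<bar>D 0 \<rho> - (\<Sum>k<n. D k \<alpha> / fact k * (\<rho> - \<alpha>) ^ k)\<bar> \<le> E M (M - j)"
    if M: "2 \<le> M" and j: "j \<in> {1..M}" and \<alpha>: "\<alpha> = rho_node b \<mu> q M (j - 1)"
      and \<rho>: "\<alpha> \<le> \<rho>" "\<rho> \<le> rho_node b \<mu> q M j" "\<rho> < b" for M j \<alpha> \<rho>
  proof -
    define h where "h = rho_step b \<mu> q M j"
    define i where "i = M - j"
    have h: "0 < h" unfolding h_def by (rule rho_step_pos[OF b q \<mu> j])
    have hle: "\<rho> - \<alpha> \<le> h" using \<rho> \<alpha> by (simp add: h_def rho_step_def)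
    have hn: "h ^ n \<le> ch * real M powr (- (r * n)) * real (Suc i) powr (r * n - n)"
      using rho_step_power_le[OF b q \<mu> j, of n] by (simp add: h_def i_def ch_def r_def)
    have t1: "b - \<alpha> = b powr \<mu> * (real (Suc i) / real M) powr r"
    proof -
      have "M - (j - 1) = Suc i" "j - 1 \<le> M" using j by (auto simp: i_def)
      then show ?thesis using diff_rho_node[OF b, of "j - 1" M \<mu> q] by (simp only: \<alpha> r_def)
    qed
    have t0: "b - rho_node b \<mu> q M j = b powr \<mu> * (real i / real M) powr r"
      using diff_rho_node[OF b, of j M \<mu> q] j by (simp add: r_def i_def)
    have iM: "Suc i \<le> M" using j by (auto simp: i_def)
    have t1le: "b - \<alpha> \<le> b powr \<mu>"
      unfolding t1 using iM r by (intro mult_left_le powr_le1) auto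
    have sub: "{\<alpha>..\<rho>} \<subseteq> {b - b powr \<mu>..<b}" using t1le \<rho> by auto
    have der: "(D k has_real_derivative D (Suc k) t) (at t within {\<alpha>..\<rho>})"
      if "k < n" "t \<in> {\<alpha>..\<rho>}" for k t
      using deriv that sub by (blast intro: DERIV_subset)
    \<comment> \<open>The kernel of the remainder is kept in the hypothesis: on the last cell it has to absorb a logarithm.\<close>
    have pointwise: "\<bar>D 0 \<rho> - (\<Sum>k<n. D k \<alpha> / fact k * (\<rho> - \<alpha>) ^ k)\<bar> \<le> S * h ^ n"
      if S: "\<And>t. t \<in> {\<alpha>..\<rho>} \<Longrightarrow> (\<rho> - t) ^ (n - 1) * \<bar>D n t\<bar> \<le> S * h ^ (n - 1)" for S
    proof -
      have "((\<lambda>t. S * h ^ (n - 1)) has_integral (S * h ^ (n - 1) * (\<rho> - \<alpha>))) {\<alpha>..\<rho>}"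
        using has_integral_const_real[of "S * h ^ (n - 1)" \<alpha> \<rho>] \<rho> by (simp add: mult_ac)
      then have "\<bar>D 0 \<rho> - (\<Sum>k<n. D k \<alpha> / fact k * (\<rho> - \<alpha>) ^ k)\<bar> \<le> S * h ^ (n - 1) * (\<rho> - \<alpha>)"
        by (intro taylor_remainder_le[OF _ \<rho>(1) der S]) (use n in auto)
      also have "\<dots> \<le> S * h ^ (n - 1) * h"
      proof (rule mult_left_mono[OF hle])
        have "0 \<le> (\<rho> - \<alpha>) ^ (n - 1) * \<bar>D n \<alpha>\<bar>" using \<rho> by simp
        also have "\<dots> \<le> S * h ^ (n - 1)" by (rule S) (use \<rho> in auto)
        finally show "0 \<le> S * h ^ (n - 1)" .
      qed
      also have "\<dots> = S * h ^ n" using n power_minus_mult[of n h] by simp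
      finally show ?thesis .
    qed
    have sup: "\<bar>D 0 \<rho> - (\<Sum>k<n. D k \<alpha> / fact k * (\<rho> - \<alpha>) ^ k)\<bar> \<le> S * h ^ n"
      if S: "\<And>t. t \<in> {\<alpha>..\<rho>} \<Longrightarrow> \<bar>D n t\<bar> \<le> S" for S
    proof (rule pointwise)
      fix t assume t: "t \<in> {\<alpha>..\<rho>}"
      have "(\<rho> - t) ^ (n - 1) \<le> h ^ (n - 1)" using t hle by (intro power_mono) auto
      then have "(\<rho> - t) ^ (n - 1) * \<bar>D n t\<bar> \<le> h ^ (n - 1) * S"
        using S[OF t] t h by (intro mult_mono) auto
      then show "(\<rho> - t) ^ (n - 1) * \<bar>D n t\<bar> \<le> S * h ^ (n - 1)" by (simp add: mult.commute)
    qed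
    show ?thesis
    proof (cases "real n" \<gamma> rule: linorder_cases)
      case less
      have "\<bar>D 0 \<rho> - (\<Sum>k<n. D k \<alpha> / fact k * (\<rho> - \<alpha>) ^ k)\<bar> \<le> c n * h ^ n"
      proof (rule sup)
        show "\<bar>D n t\<bar> \<le> c n" if "t \<in> {\<alpha>..\<rho>}" for t
          using Dn[of t] that sub less by (auto simp: W_def)
      qed
      also have "\<dots> \<le> c n * (ch * real M powr (- (r * n)) * real (Suc i) powr (r * n - n))"
        by (intro mult_left_mono hn cn)
      also have "\<dots> = E M (M - j)"
        using less by (simp add: E_def C_def log_factor_def i_def min_def mult_ac)
      finally show ?thesis .
    next
      case equal
      have lnbd: "2 + \<bar>ln t\<bar> \<le> cl * ln (real M)"
        if "b powr \<mu> * (real k / real M) powr r \<le> t" "t \<le> b powr \<mu>" "1 \<le> k" "k \<le> M" for t k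
        unfolding cl_def by (rule abs_ln_cell_le[OF b r _ _ \<mu> M that(1,2)]) (use that in auto)
      have "\<bar>D 0 \<rho> - (\<Sum>k<n. D k \<alpha> / fact k * (\<rho> - \<alpha>) ^ k)\<bar> \<le> (c n * (cl * ln (real M))) * h ^ n"
      proof (cases "i = 0")
        case False
        show ?thesis
        proof (rule sup)
          fix t assume t: "t \<in> {\<alpha>..\<rho>}"
          have "2 + \<bar>ln (b - t)\<bar> \<le> cl * ln (real M)"
            using t t0 t1le \<rho> False iM by (intro lnbd[of i]) auto
          then have "c n * (1 + \<bar>ln (b - t)\<bar>) \<le> c n * (cl * ln (real M))"
            by (intro mult_left_mono cn) auto
          then show "\<bar>D n t\<bar> \<le> c n * (cl * ln (real M))" using Dn[of t] t sub equal by (auto simp: W_def)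
        qed
      next
        case True
        have hb: "h = b - \<alpha>" using t0 True by (simp add: h_def rho_step_def \<alpha>)
        have lnh: "2 + \<bar>ln h\<bar> \<le> cl * ln (real M)"
          using t1 t1le True iM by (intro lnbd[of 1]) (auto simp: hb)
        show ?thesis
        proof (rule pointwise)
          fix t assume t: "t \<in> {\<alpha>..\<rho>}"
          have "(\<rho> - t) ^ (n - 1) * \<bar>D n t\<bar> \<le> (b - t) ^ (n - 1) * (c n * (1 + \<bar>ln (b - t)\<bar>))"
            using t \<rho> Dn[of t] sub equal by (intro mult_mono power_mono) (auto simp: W_def)
          also have "\<dots> = c n * ((b - t) ^ (n - 1) * (1 + \<bar>ln (b - t)\<bar>))" by simp
          also have "\<dots> \<le> c n * (h ^ (n - 1) * (2 + \<bar>ln h\<bar>))"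
            using t \<rho> hb n by (intro mult_left_mono cn power_times_ln_le) auto
          also have "\<dots> \<le> c n * (h ^ (n - 1) * (cl * ln (real M)))"
            using lnh h by (intro mult_left_mono cn) auto
          finally show "(\<rho> - t) ^ (n - 1) * \<bar>D n t\<bar> \<le> c n * (cl * ln (real M)) * h ^ (n - 1)"
            by (simp add: mult_ac)
        qed
      qed
      also have "\<dots> \<le> (c n * (cl * ln (real M)))
          * (ch * real M powr (- (r * n)) * real (Suc i) powr (r * n - n))"
        using M cn cl by (intro mult_left_mono hn) auto
      also have "\<dots> = E M (M - j)"
        using equal by (simp add: E_def C_def log_factor_def i_def min_def mult_ac)
      finally show ?thesis .
    next
      case greater
      define K1 where "K1 = ch * (b powr \<mu> * (1 / 2) powr r) powr (\<gamma> - n)"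
      define K2 where "K2 = (b powr \<mu>) powr \<gamma> / \<gamma>"
      have K: "0 \<le> K1" "0 \<le> K2" using ch \<gamma> by (auto simp: K1_def K2_def)
      have E: "E M (M - j) = c n * (K1 + K2) * real M powr (- (r * \<gamma>)) * real (Suc i) powr (r * \<gamma> - n)"
        using greater by (simp add: E_def C_def K1_def K2_def log_factor_def i_def min_def mult_ac)
      show ?thesis
      proof (cases "i = 0")
        case False
        \<comment> \<open>\<open>T\<close> is a lower bound for the distance from the cell to the singularity, in terms of \<open>Suc i\<close>: \<open>i \<ge> Suc i / 2\<close>.\<close>
        define T where "T = b powr \<mu> * (1 / 2) powr r * (real (Suc i) / real M) powr r"
        have T: "0 < T" using b iM by (simp add: T_def)
        have "T = b powr \<mu> * ((1 / 2) * (real (Suc i) / real M)) powr r"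
          unfolding T_def by (simp add: powr_mult[symmetric] del: of_nat_Suc)
        also have "\<dots> \<le> b powr \<mu> * (real i / real M) powr r"
          using False r iM by (intro mult_left_mono powr_mono2) (auto simp: field_simps)
        finally have Tt: "T \<le> b - rho_node b \<mu> q M j" by (simp add: t0)
        have "\<bar>D 0 \<rho> - (\<Sum>k<n. D k \<alpha> / fact k * (\<rho> - \<alpha>) ^ k)\<bar> \<le> (c n * T powr (\<gamma> - n)) * h ^ n"
        proof (rule sup)
          fix t assume t: "t \<in> {\<alpha>..\<rho>}"
          have "\<bar>D n t\<bar> \<le> c n * (b - t) powr (\<gamma> - n)"
            using Dn[of t] t sub greater by (auto simp: W_def)
          also have "\<dots> \<le> c n * T powr (\<gamma> - n)"
            using T Tt t \<rho> greater by (intro mult_left_mono cn powr_mono2') auto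
          finally show "\<bar>D n t\<bar> \<le> c n * T powr (\<gamma> - n)" .
        qed
        also have "\<dots> \<le> (c n * T powr (\<gamma> - n))
            * (ch * real M powr (- (r * n)) * real (Suc i) powr (r * n - n))"
          using cn by (intro mult_left_mono hn) auto
        also have "T powr (\<gamma> - n) = (b powr \<mu> * (1 / 2) powr r) powr (\<gamma> - n)
            * (real (Suc i) powr (r * (\<gamma> - n)) * real M powr (- (r * (\<gamma> - n))))"
        proof -
          have "(Q * (x / y) powr r) powr e = Q powr e * (x powr (r * e) * y powr (- (r * e)))"
            if "0 \<le> x" "0 \<le> y" "0 \<le> Q" for Q x y e :: real
            using that by (simp add: powr_mult powr_divide powr_powr powr_minus_divide)
          then show ?thesis unfolding T_def by simp
        qed
        also have "(c n * ((b powr \<mu> * (1 / 2) powr r) powr (\<gamma> - n)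
            * (real (Suc i) powr (r * (\<gamma> - n)) * real M powr (- (r * (\<gamma> - n))))))
            * (ch * real M powr (- (r * n)) * real (Suc i) powr (r * n - n))
          = c n * K1 * (real M powr (- (r * (\<gamma> - n))) * real M powr (- (r * n)))
            * (real (Suc i) powr (r * (\<gamma> - n)) * real (Suc i) powr (r * n - n))"
          by (simp only: K1_def mult_ac)
        also have "\<dots> = c n * K1 * real M powr (- (r * \<gamma>)) * real (Suc i) powr (r * \<gamma> - n)"
          unfolding powr_add[symmetric] by (simp add: algebra_simps)
        also have "\<dots> \<le> E M (M - j)"
          unfolding E using K cn by (intro mult_right_mono mult_left_mono) auto
        finally show ?thesis .
      next
        case True
        have hb: "h = b - \<alpha>" using t0 True by (simp add: h_def rho_step_def \<alpha>)
        \<comment> \<open>On the last cell \<open>\<rho> - t \<le> b - t\<close>, so the remainder is dominated by the integrable power \<open>(b - t) powr (\<gamma> - 1)\<close>.\<close>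
        have FTC: "((\<lambda>t. c n * (b - t) powr (\<gamma> - 1)) has_integral
            (- (c n * ((b - \<rho>) powr \<gamma> / \<gamma>)) - (- (c n * ((b - \<alpha>) powr \<gamma> / \<gamma>))))) {\<alpha>..\<rho>}"
          using \<rho> \<gamma>
          by (intro fundamental_theorem_of_calculus)
             (auto intro!: derivative_eq_intros simp flip: has_real_derivative_iff_has_vector_derivative)
        have "\<bar>D 0 \<rho> - (\<Sum>k<n. D k \<alpha> / fact k * (\<rho> - \<alpha>) ^ k)\<bar>
            \<le> - (c n * ((b - \<rho>) powr \<gamma> / \<gamma>)) - (- (c n * ((b - \<alpha>) powr \<gamma> / \<gamma>)))"
        proof (rule taylor_remainder_le[where D = D and n = n, OF _ \<rho>(1) der _ FTC])
          fix t assume t: "t \<in> {\<alpha>..\<rho>}"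
          have "(\<rho> - t) ^ (n - 1) * \<bar>D n t\<bar> \<le> (b - t) ^ (n - 1) * (c n * (b - t) powr (\<gamma> - n))"
            using t \<rho> Dn[of t] sub greater by (intro mult_mono power_mono) (auto simp: W_def)
          also have "\<dots> = c n * ((b - t) powr real (n - 1) * (b - t) powr (\<gamma> - n))"
            using t \<rho> by (simp add: powr_realpow)
          also have "\<dots> = c n * (b - t) powr (\<gamma> - 1)"
            unfolding powr_add[symmetric] using n by (simp add: of_nat_diff)
          finally show "(\<rho> - t) ^ (n - 1) * \<bar>D n t\<bar> \<le> c n * (b - t) powr (\<gamma> - 1)" .
        qed (use n in auto)
        also have "\<dots> \<le> c n * ((b - \<alpha>) powr \<gamma> / \<gamma>)" using cn \<gamma> by simp
        also have "(b - \<alpha>) powr \<gamma> / \<gamma> = K2 * real M powr (- (r * \<gamma>))"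
          unfolding t1 K2_def True by (simp add: powr_mult powr_divide powr_powr powr_minus_divide)
        also have "c n * (K2 * real M powr (- (r * \<gamma>))) \<le> E M (M - j)"
          unfolding E True using K cn by (simp add: mult.assoc mult_left_mono mult_right_mono)
        finally show ?thesis .
      qed
    qed
  qed
  show ?thesis
  proof (rule that[OF C])
    fix M j :: nat assume M: "2 \<le> M" and j: "j \<in> {1..M}"
    define \<alpha> where "\<alpha> = rho_node b \<mu> q M (j - 1)"
    define h where "h = rho_step b \<mu> q M j"
    define cf where "cf k = D k \<alpha> / fact k * h ^ k" for k
    define G where "G \<theta> = \<bar>f (cell_point b \<mu> q M j \<theta>) - (\<Sum>k<n. cf k * \<theta> ^ k)\<bar>" for \<theta>
    have h: "0 < h" unfolding h_def by (rule rho_step_pos[OF b q \<mu> j])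
    have inner: "G \<theta> \<le> E M (M - j)" if \<theta>: "\<theta> \<in> {0..<1}" for \<theta>
    proof -
      have \<theta>': "\<theta> \<in> {0..1}" using \<theta> by auto
      define \<rho> where "\<rho> = cell_point b \<mu> q M j \<theta>"
      have \<rho>: "\<rho> = \<alpha> + \<theta> * h" by (simp add: \<rho>_def cell_point_def \<alpha>_def h_def)
      have "\<rho> < \<alpha> + 1 * h" using h \<theta> unfolding \<rho> by (intro add_strict_left_mono mult_strict_right_mono) auto
      also have "\<dots> \<le> b"
      proof -
        have "rho_node b \<mu> q M j \<le> b" by (simp add: rho_node_def)
        then show ?thesis using rho_node_split[of b \<mu> q M j] by (simp add: \<alpha>_def h_def)
      qed
      finally have "\<rho> < b" .
      moreover have "\<alpha> \<le> \<rho>" "\<rho> \<le> rho_node b \<mu> q M j" "\<rho> \<in> {b - b powr \<mu>..b}"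
        unfolding \<rho>_def \<alpha>_def using cell_point_bounds[OF b q \<mu> j \<theta>'] by auto
      ultimately have "\<bar>f \<rho> - (\<Sum>k<n. D k \<alpha> / fact k * (\<rho> - \<alpha>) ^ k)\<bar> \<le> E M (M - j)"
        using main[OF M j \<alpha>_def, of \<rho>] D0 by auto
      then show ?thesis
        unfolding G_def \<rho>_def[symmetric] by (simp add: \<rho> cf_def power_mult_distrib mult_ac)
    qed
    \<comment> \<open>The right end of the last cell is the singular point itself, where only continuity is left.\<close>
    have "continuous_on {0..1} (\<lambda>\<theta>. f (cell_point b \<mu> q M j \<theta>))"
      using cell_point_bounds(3)[OF b q \<mu> j]
      by (intro continuous_on_compose2[OF contf]) (auto simp: cell_point_def intro!: continuous_intros)
    then have contG: "continuous_on {0..1} G"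
      unfolding G_def by (intro continuous_intros)
    have "G \<theta> \<le> E M (M - j)" if "\<theta> \<in> {0..1}" for \<theta>
      by (rule continuous_le_on_closure[of "{0..<1}" G \<theta>]) (use that contG inner in auto)
    then show "\<exists>c. \<forall>\<theta>\<in>{0..1}. \<bar>f (cell_point b \<mu> q M j \<theta>) - (\<Sum>k<n. c k * \<theta> ^ k)\<bar>
       \<le> C * log_factor n \<gamma> M * real M powr (- (q * \<mu> * min n \<gamma>))
           * real (Suc (M - j)) powr (q * \<mu> * min n \<gamma> - n)"
      by (intro exI[of _ cf]) (auto simp: G_def E_def r_def)
  qed
qed

section \<open>Existence, uniqueness and stability of collocation\<close>

text \<open>The situation common to existence, uniqueness and convergence. All that these need from the
  integro-differential equation is that its right-hand side is Lipschitz continuous in the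
  Volterra sense.\<close>
locale collocation =
  fixes b \<nu> \<mu> q :: real and n :: nat and \<xi> :: "nat \<Rightarrow> real"
    and a chi :: "real \<Rightarrow> real" and K :: "real \<Rightarrow> real \<Rightarrow> real" and A0 :: real
  assumes b: "0 < b" and \<mu>: "0 < \<mu>" and q: "1 \<le> q"
    and \<xi>: "\<xi> ` {1..n} \<subseteq> {0..1}"
    and A0: "0 < A0"
    and rhs_lipschitz: "\<And>x f g B. \<lbrakk>x \<in> {0..b}; continuous_on {x..b} f; continuous_on {x..b} g;
           \<And>t. t \<in> {x..b} \<Longrightarrow> \<bar>f t - g t\<bar> \<le> B\<rbrakk>
         \<Longrightarrow> \<bar>avide_rhs b \<nu> a chi K f x - avide_rhs b \<nu> a chi K g x\<bar> \<le> A0 * B"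
begin

abbreviation "X \<equiv> node b q"
abbreviation "L \<equiv> frac_lagrange b \<mu> q n \<xi>"
abbreviation "pt \<equiv> colloc_pt b \<mu> q \<xi>"
abbreviation "rhs \<equiv> avide_rhs b \<nu> a chi K"

text \<open>Lipschitz constant of the map that takes \<open>f\<close> to the interpolant of the right-hand side of \<open>f\<close>. Adding
  one makes it positive, so that the weight exponent \<open>4 * A\<close> is a legitimate divisor.\<close>
definition A :: real where "A = lebesgue_bound \<xi> {1..n} * A0 + 1"

text \<open>The quotient \<open>b * (1 + 2 * q) / M\<close> bounds all mesh steps; see \<open>mesh_size\<close>.\<close>
definition fine_mesh :: "nat \<Rightarrow> bool" where
  "fine_mesh M \<longleftrightarrow> 0 < M \<and> exp (4 * A * (b * (1 + 2 * q) / real M)) \<le> 2"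

lemma A_pos: "0 < A"
  using lebesgue_bound_nonneg[of \<xi> "{1..n}"] A0 by (simp add: A_def add_nonneg_pos)

lemma q_pos: "0 < q" using q by simp

lemmas mono_X = mono_node[OF b q_pos]

lemma cell_ends:
  assumes "j \<in> {1..M}"
  shows "X M (j - 1) \<in> {0..b}" "X M j \<in> {0..b}" "X M (j - 1) \<le> X M j"
proof -
  have "0 < M" "j - 1 \<le> M" "j \<le> M" using assms by auto
  then show "X M (j - 1) \<in> {0..b}" "X M j \<in> {0..b}" using node_in[OF b q_pos] by blast+
  show "X M (j - 1) \<le> X M j" using assms by (intro mono_onD[OF mono_X]) auto
qed

lemma mesh_size:
  assumes "j \<in> {1..M}"
  shows "X M j - X M (j - 1) \<le> b * (1 + 2 * q) / real M"
proof -
  have "X M j - X M (j - 1) \<le> b * (1 + 2 * q) * real M powr (- q) * real (Suc (M - j)) powr (q - 1)"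
    by (rule node_step_le[OF b q_pos assms])
  also have "\<dots> \<le> b * (1 + 2 * q) * real M powr (- q) * real M powr (q - 1)"
    using assms q b by (intro mult_left_mono powr_mono2) auto
  also have "\<dots> = b * (1 + 2 * q) * (real M powr (- q) * real M powr (q - 1))" by simp
  also have "\<dots> = b * (1 + 2 * q) / real M"
    unfolding powr_add[symmetric] using assms by (simp add: powr_minus_divide)
  finally show ?thesis .
qed

lemma pt_in:
  assumes "j \<in> {1..M}" "l \<in> {1..n}"
  shows "pt M j l \<in> {X M (j - 1)..X M j}" "pt M j l \<in> {0..b}"
proof -
  have "\<xi> l \<in> {0..1}" using \<xi> assms(2) by blast
  then show 1: "pt M j l \<in> {X M (j - 1)..X M j}"
    unfolding colloc_pt_eq by (rule tau_cell_point_in[OF b q_pos \<mu> assms(1)])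
  show "pt M j l \<in> {0..b}"
    using 1 cell_ends[OF assms(1)] by auto
qed

lemma fractional_sum_le:
  assumes "j \<in> {1..M}" "s \<in> {X M (j - 1)..X M j}"
    and "\<And>k. k \<in> {1..n} \<Longrightarrow> \<bar>y k\<bar> \<le> B" "0 \<le> B"
  shows "\<bar>\<Sum>k=1..n. y k * L M j k s\<bar> \<le> lebesgue_bound \<xi> {1..n} * B"
proof -
  have "(\<Sum>k=1..n. y k * L M j k s)
      = (\<Sum>k=1..n. y k * lagrange_basis \<xi> {1..n} k (cell_coord b \<mu> q M j s))"
    by (intro sum.cong) (auto simp: frac_lagrange_eq_lagrange_basis[OF b q_pos \<mu> assms(1) \<xi>])
  then show ?thesis
    using abs_lagrange_sum_le[OF _ \<xi> cell_coord_in(1)[OF b q_pos \<mu> assms(1,2)] assms(3,4)] by simp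
qed

lemma rhs_interpolant_diff_le:
  assumes j: "j \<in> {1..M}" and s: "s \<in> {X M (j - 1)<..X M j}"
    and f: "continuous_on {0..b} f" and g: "continuous_on {0..b} g"
    and B: "\<And>t. t \<in> {X M (j - 1)..b} \<Longrightarrow> \<bar>f t - g t\<bar> \<le> B"
  shows "\<bar>\<Sum>k=1..n. (rhs f (pt M j k) - rhs g (pt M j k)) * L M j k s\<bar> \<le> A * B"
proof -
  have Xb: "X M (j - 1) \<le> b" "0 \<le> X M (j - 1)" using cell_ends[OF j] by auto
  have B0: "0 \<le> B" using B[of b] Xb by auto
  have "\<bar>rhs f (pt M j k) - rhs g (pt M j k)\<bar> \<le> A0 * B" if k: "k \<in> {1..n}" for k
  proof (rule rhs_lipschitz)
    show "pt M j k \<in> {0..b}" by (rule pt_in[OF j k])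
    then show "continuous_on {pt M j k..b} f" "continuous_on {pt M j k..b} g"
      by (auto intro: continuous_on_subset[OF f] continuous_on_subset[OF g])
    show "\<bar>f t - g t\<bar> \<le> B" if "t \<in> {pt M j k..b}" for t
      using pt_in(1)[OF j k] that by (intro B) auto
  qed
  then have "\<bar>\<Sum>k=1..n. (rhs f (pt M j k) - rhs g (pt M j k)) * L M j k s\<bar>
      \<le> lebesgue_bound \<xi> {1..n} * (A0 * B)"
    using s A0 B0 by (intro fractional_sum_le[OF j]) auto
  also have "\<dots> \<le> A * B" using B0 by (simp add: A_def algebra_simps)
  finally show ?thesis .
qed

lemma piecewise_integrable:
  assumes "0 < M"
    and "\<And>j s. \<lbrakk>j \<in> {1..M}; s \<in> {X M (j - 1)<..X M j}\<rbrakk> \<Longrightarrow> f s = (\<Sum>k=1..n. Y j k * L M j k s)"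
  shows "f integrable_on {0..b}"
proof -
  have "(f has_integral integral {X M (j - 1)..X M j} (\<lambda>s. \<Sum>k=1..n. Y j k * L M j k s))
      {X M (j - 1)..X M j}" if j: "j \<in> {1..M}" for j
  proof (rule has_integral_spike_finite[of "{X M (j - 1)}"])
    have "X M j \<le> b" using cell_ends[OF j] by auto
    then have "continuous_on {X M (j - 1)..X M j} (L M j k)" for k
      by (intro continuous_on_frac_lagrange[OF \<mu>]) auto
    then have "(\<lambda>s. \<Sum>k=1..n. Y j k * L M j k s) integrable_on {X M (j - 1)..X M j}"
      by (intro integrable_continuous_interval continuous_intros)
    then show "((\<lambda>s. \<Sum>k=1..n. Y j k * L M j k s) has_integral
        integral {X M (j - 1)..X M j} (\<lambda>s. \<Sum>k=1..n. Y j k * L M j k s)) {X M (j - 1)..X M j}"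
      by (rule integrable_integral)
  qed (use assms(2)[OF j] in auto)
  from has_integral_mesh[OF mono_X this] show ?thesis using assms(1) by auto
qed

lemma cell_exists:
  assumes M: "0 < M" and x: "x \<in> {0..b}"
  shows "\<exists>j. j \<in> {1..M} \<and> x \<in> {X M (j - 1)..X M j}"
proof (cases "x = 0")
  case True
  have "1 \<in> {1..M}" using M by simp
  moreover from cell_ends(2)[OF this] have "0 \<le> X M 1" by simp
  moreover have "X M (1 - 1) = 0" using M by simp
  ultimately show ?thesis using True by (intro exI[of _ 1]) simp
next
  case False
  then have "X M 0 < x" "x \<le> X M M" using M x by simp_all
  then obtain j where "j \<in> {1..M}" "x \<in> {X M (j - 1)<..X M j}" by (rule mesh_cell_exists)
  then show ?thesis by (intro exI[of _ j]) simp
qed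

lemma continuous_on_tail_integral:
  fixes f :: "real \<Rightarrow> real"
  assumes "f integrable_on {0..b}"
  shows "continuous_on {0..b} (\<lambda>x. integral {x..b} f)"
proof -
  have "integral {x..b} f = integral {0..b} f - integral {0..x} f" if "x \<in> {0..b}" for x
    using Henstock_Kurzweil_Integration.integral_combine[of 0 x b f] that assms by auto
  moreover have "continuous_on {0..b} (\<lambda>x. integral {0..b} f - integral {0..x} f)"
    by (intro continuous_intros indefinite_integral_continuous_1 assms)
  ultimately show ?thesis by (metis (no_types, lifting) continuous_on_eq)
qed

text \<open>The recursion for \<open>\<phi>h\<close> over the cells, started at \<open>b\<close>, is equivalent to one integral equation on the
  whole interval, which is the form that the Volterra estimates need.\<close>
lemma collocation_approxD:
  assumes "0 < M" and app: "collocation_approx b \<nu> \<mu> q n \<xi> a chi K \<phi>b M Y \<psi>h \<phi>h"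
  shows "\<And>j s. \<lbrakk>j \<in> {1..M}; s \<in> {X M (j - 1)<..X M j}\<rbrakk> \<Longrightarrow> \<psi>h s = (\<Sum>k=1..n. Y j k * L M j k s)"
    and "\<And>j l. \<lbrakk>j \<in> {1..M}; l \<in> {1..n}\<rbrakk> \<Longrightarrow> Y j l = rhs \<phi>h (pt M j l)"
    and "\<psi>h integrable_on {0..b}"
    and "\<And>x. x \<in> {0..b} \<Longrightarrow> \<phi>h x = \<phi>b - integral {x..b} \<psi>h"
    and "continuous_on {0..b} \<phi>h"
proof -
  show psi: "\<psi>h s = (\<Sum>k=1..n. Y j k * L M j k s)" if "j \<in> {1..M}" "s \<in> {X M (j - 1)<..X M j}" for j s
    using app that unfolding collocation_approx_def by blast
  show "Y j l = rhs \<phi>h (pt M j l)" if "j \<in> {1..M}" "l \<in> {1..n}" for j l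
    using app that unfolding collocation_approx_def by blast
  have phi: "\<phi>h x = \<phi>h (X M j) - integral {x..X M j} \<psi>h"
    if "j \<in> {1..M}" "x \<in> {X M (j - 1)..X M j}" for j x
    using app that unfolding collocation_approx_def by blast
  have phib: "\<phi>h b = \<phi>b" using app unfolding collocation_approx_def by blast
  show int: "\<psi>h integrable_on {0..b}" by (rule piecewise_integrable[OF assms(1) psi])
  have comb: "integral {x..X M j} \<psi>h + integral {X M j..b} \<psi>h = integral {x..b} \<psi>h"
    if "0 \<le> x" "x \<le> X M j" "j \<le> M" for x j
    using that node_in[OF b q_pos assms(1), of j]
    by (intro Henstock_Kurzweil_Integration.integral_combine integrable_on_subinterval[OF int]) auto
  have nodes: "\<phi>h (X M (M - k)) = \<phi>b - integral {X M (M - k)..b} \<psi>h" if "k \<le> M" for k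
    using that
  proof (induction k)
    case 0 then show ?case by (simp add: phib)
  next
    case (Suc k)
    define j where "j = M - k"
    have j: "j \<in> {1..M}" "M - Suc k = j - 1" using Suc.prems by (auto simp: j_def)
    have le: "X M (j - 1) \<le> X M j" "0 \<le> X M (j - 1)"
      using cell_ends[OF j(1)] by auto
    have "\<phi>h (X M (j - 1)) = \<phi>h (X M j) - integral {X M (j - 1)..X M j} \<psi>h"
      using le by (intro phi j) auto
    then show ?case
      using Suc comb[OF le(2,1)] j by (simp add: j_def[symmetric])
  qed
  show eq: "\<phi>h x = \<phi>b - integral {x..b} \<psi>h" if x: "x \<in> {0..b}" for x
  proof -
    obtain j where j: "j \<in> {1..M}" "x \<in> {X M (j - 1)..X M j}" using cell_exists[OF assms(1) x] by blast
    have "\<phi>h (X M j) = \<phi>b - integral {X M j..b} \<psi>h" using nodes[of "M - j"] j by auto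
    then show ?thesis using phi[OF j] comb[of x j] x j by simp
  qed
  have "continuous_on {0..b} (\<lambda>x. \<phi>b - integral {x..b} \<psi>h)"
    by (intro continuous_intros continuous_on_tail_integral int)
  then show "continuous_on {0..b} \<phi>h" by (rule continuous_on_eq) (simp add: eq)
qed

definition piecewise_interpolant :: "nat \<Rightarrow> (nat \<Rightarrow> nat \<Rightarrow> real) \<Rightarrow> real \<Rightarrow> real" where
  "piecewise_interpolant M Y s
     = (\<Sum>k=1..n. Y (mesh_cell (X M) s) k * L M (mesh_cell (X M) s) k s)"

lemma piecewise_interpolant_eq:
  assumes "j \<in> {1..M}" "s \<in> {X M (j - 1)<..X M j}"
  shows "piecewise_interpolant M Y s = (\<Sum>k=1..n. Y j k * L M j k s)"
  unfolding piecewise_interpolant_def mesh_cell_eq[OF mono_X assms] ..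

lemma collocation_approxI:
  assumes "0 < M"
    and Y: "\<And>j l. \<lbrakk>j \<in> {1..M}; l \<in> {1..n}\<rbrakk> \<Longrightarrow> Y j l = rhs \<phi>h (pt M j l)"
    and \<phi>h: "\<And>x. x \<in> {0..b} \<Longrightarrow> \<phi>h x = \<phi>b - integral {x..b} (piecewise_interpolant M Y)"
  shows "collocation_approx b \<nu> \<mu> q n \<xi> a chi K \<phi>b M Y (piecewise_interpolant M Y) \<phi>h"
proof -
  let ?\<psi> = "piecewise_interpolant M Y"
  have int: "?\<psi> integrable_on {0..b}"
    by (rule piecewise_integrable[OF assms(1) piecewise_interpolant_eq])
  have "\<phi>h x = \<phi>h (X M j) - integral {x..X M j} ?\<psi>"
    if j: "j \<in> {1..M}" and x: "x \<in> {X M (j - 1)..X M j}" for j x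
  proof -
    have Xj: "X M j \<in> {0..b}" "0 \<le> X M (j - 1)"
      using cell_ends[OF j] by auto
    have "integral {x..X M j} ?\<psi> + integral {X M j..b} ?\<psi> = integral {x..b} ?\<psi>"
      using x Xj by (intro Henstock_Kurzweil_Integration.integral_combine integrable_on_subinterval[OF int]) auto
    then show ?thesis using \<phi>h[of x] \<phi>h[OF Xj(1)] x Xj by auto
  qed
  moreover have "\<phi>h b = \<phi>b" using \<phi>h[of b] b by simp
  ultimately show ?thesis
    unfolding collocation_approx_def using piecewise_interpolant_eq Y by blast
qed

text \<open>The collocation equations are a fixed point problem for the continuous function \<open>\<phi>h\<close>: evaluate the
  right-hand side at the collocation points, interpolate, integrate. On a fine mesh this map
  contracts the weighted norm by \<open>1 / 2\<close>. The weight is built into the unknown \<open>u = \<phi>h / w\<close>, so that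
  Banach's theorem applies to bounded continuous functions with their usual metric; functions on
  the interval are extended constantly to the real line.\<close>
lemma collocation_solvable:
  assumes fine: "fine_mesh M"
  shows "\<exists>Y \<psi>h \<phi>h. collocation_approx b \<nu> \<mu> q n \<xi> a chi K \<phi>b M Y \<psi>h \<phi>h"
proof -
  have M: "0 < M" and H: "exp (4 * A * (b * (1 + 2 * q) / real M)) \<le> 2"
    using fine by (auto simp: fine_mesh_def)
  define w where "w s = exp (4 * A * (b - s))" for s
  define cl where "cl x = max 0 (min x b)" for x
  define \<Psi> where "\<Psi> f = piecewise_interpolant M (\<lambda>j l. rhs f (pt M j l))" for f
  define T where "T u x = (\<phi>b - integral {cl x..b} (\<Psi> (\<lambda>s. w s * u s))) / w (cl x)" for u x
  have wpos: "0 < w s" for s by (simp add: w_def)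
  have cl: "cl x \<in> {0..b}" for x using b by (auto simp: cl_def)
  have cl_id: "cl x = x" if "x \<in> {0..b}" for x using that by (auto simp: cl_def)
  have int: "\<Psi> f integrable_on {0..b}" for f
    unfolding \<Psi>_def by (rule piecewise_integrable[OF M piecewise_interpolant_eq])
  have T_bcont: "T u \<in> bcontfun" for u
  proof -
    define h where "h x = (\<phi>b - integral {x..b} (\<Psi> (\<lambda>s. w s * u s))) / w x" for x
    have h: "continuous_on {0..b} h"
      unfolding h_def using wpos
      by (intro continuous_intros continuous_on_tail_integral int) (auto simp: w_def intro!: continuous_intros)
    have "continuous_on UNIV (\<lambda>x. h (cl x))"
      by (rule continuous_on_compose2[OF h]) (use cl in \<open>auto simp: cl_def intro!: continuous_intros\<close>)
    moreover have "range (\<lambda>x. h (cl x)) \<subseteq> h ` {0..b}" using cl by auto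
    moreover have "bounded (h ` {0..b})" by (intro compact_imp_bounded compact_continuous_image h) auto
    ultimately show ?thesis
      by (auto simp: bcontfun_def T_def[abs_def] h_def intro: bounded_subset)
  qed
  define F :: "(real \<Rightarrow>\<^sub>C real) \<Rightarrow> (real \<Rightarrow>\<^sub>C real)" where "F u = Bcontfun (T u)" for u
  have F: "apply_bcontfun (F u) = T u" for u
    unfolding F_def by (rule Bcontfun_inverse[OF T_bcont])
  have "dist (F u) (F v) \<le> 1 / 2 * dist u v" for u v :: "real \<Rightarrow>\<^sub>C real"
  proof (rule dist_bound)
    fix x
    let ?f = "\<lambda>s. w s * u s" and ?g = "\<lambda>s. w s * v s"
    have cont: "continuous_on {0..b} ?f" "continuous_on {0..b} ?g"
      unfolding w_def by (intro continuous_intros; simp)+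
    have "\<bar>integral {cl x..b} (\<lambda>s. \<Psi> ?f s - \<Psi> ?g s)\<bar>
      \<le> (\<Sum>j=1..M. 0 * (X M j - X M (j - 1))) + dist u v / 2 * exp (4 * A * (b - cl x))"
    proof (rule weighted_volterra_bound[OF mono_X _ _ mesh_size H A_pos, where d = "\<lambda>s. ?f s - ?g s"])
      show "(\<lambda>s. \<Psi> ?f s - \<Psi> ?g s) integrable_on {0..b}" by (intro integrable_diff int)
      show "\<bar>?f s - ?g s\<bar> \<le> dist u v * exp (4 * A * (b - s))" for s
      proof -
        have "\<bar>?f s - ?g s\<bar> = w s * \<bar>u s - v s\<bar>"
          using wpos[of s] by (simp add: right_diff_distrib[symmetric] abs_mult)
        also have "\<dots> \<le> w s * dist u v"
          using dist_bounded[of u s v] wpos[of s] by (intro mult_left_mono) (auto simp: dist_real_def)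
        finally show ?thesis by (simp add: w_def mult.commute)
      qed
      fix j s B assume j: "j \<in> {1..M}" and s: "s \<in> {X M (j - 1)<..X M j}"
        and B: "\<And>t. t \<in> {X M (j - 1)..b} \<Longrightarrow> \<bar>?f t - ?g t\<bar> \<le> B"
      show "\<bar>\<Psi> ?f s - \<Psi> ?g s\<bar> \<le> 0 + A * B"
        using rhs_interpolant_diff_le[OF j s cont B]
        by (simp add: \<Psi>_def piecewise_interpolant_eq[OF j s] left_diff_distrib sum_subtractf)
    qed (use M cl in auto)
    then have "\<bar>integral {cl x..b} (\<lambda>s. \<Psi> ?f s - \<Psi> ?g s)\<bar> \<le> dist u v / 2 * w (cl x)"
      by (simp add: w_def)
    moreover have "integral {cl x..b} (\<lambda>s. \<Psi> ?f s - \<Psi> ?g s)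
        = integral {cl x..b} (\<Psi> ?f) - integral {cl x..b} (\<Psi> ?g)"
      using cl[of x] by (intro integral_diff integrable_on_subinterval[OF int]) auto
    moreover have "T u x - T v x = - (integral {cl x..b} (\<Psi> ?f) - integral {cl x..b} (\<Psi> ?g)) / w (cl x)"
      by (simp add: T_def diff_divide_distrib)
    ultimately show "dist (F u x) (F v x) \<le> 1 / 2 * dist u v"
      using wpos[of "cl x"] by (simp add: F dist_real_def abs_divide abs_minus_commute pos_divide_le_eq)
  qed
  then obtain u where u: "F u = u"
    using banach_fix_type[of "1/2" F] by auto
  define \<phi>h where "\<phi>h s = w s * u s" for s
  have "collocation_approx b \<nu> \<mu> q n \<xi> a chi K \<phi>b M (\<lambda>j l. rhs \<phi>h (pt M j l))
     (piecewise_interpolant M (\<lambda>j l. rhs \<phi>h (pt M j l))) \<phi>h"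
  proof (rule collocation_approxI[OF M])
    fix x assume x: "x \<in> {0..b}"
    have "u x = T u x" using F[of u] u by simp
    then show "\<phi>h x = \<phi>b - integral {x..b} (piecewise_interpolant M (\<lambda>j l. rhs \<phi>h (pt M j l)))"
      using wpos[of x] by (simp add: T_def cl_id[OF x] \<phi>h_def[abs_def] \<Psi>_def)
  qed simp
  then show ?thesis by blast
qed

text \<open>The difference of two approximations satisfies the same Volterra inequality with zero data.\<close>
lemma collocation_unique:
  assumes fine: "fine_mesh M"
    and app: "collocation_approx b \<nu> \<mu> q n \<xi> a chi K \<phi>b M Y \<psi>h \<phi>h"
    and app': "collocation_approx b \<nu> \<mu> q n \<xi> a chi K \<phi>b M Y' \<psi>h' \<phi>h'"
    and j: "j \<in> {1..M}" and l: "l \<in> {1..n}"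
  shows "Y j l = Y' j l"
proof -
  have M: "0 < M" and H: "exp (4 * A * (b * (1 + 2 * q) / real M)) \<le> 2"
    using fine by (auto simp: fine_mesh_def)
  note D = collocation_approxD[OF M app] and D' = collocation_approxD[OF M app']
  have int: "(\<lambda>s. \<psi>h s - \<psi>h' s) integrable_on {0..b}" by (intro integrable_diff D D')
  have "\<bar>\<phi>h x - \<phi>h' x\<bar> \<le> 2 * exp (4 * A * b) * (\<Sum>j=1..M. 0 * (X M j - X M (j - 1)))"
    if x: "x \<in> {0..b}" for x
  proof (rule volterra_stability[OF mono_X _ _ mesh_size H A_pos int, where d = "\<lambda>x. \<phi>h x - \<phi>h' x"])
    show "continuous_on {0..b} (\<lambda>x. \<phi>h x - \<phi>h' x)" by (intro continuous_intros D D')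
    fix x assume x: "x \<in> {0..b}"
    then have "integral {x..b} (\<lambda>s. \<psi>h s - \<psi>h' s) = integral {x..b} \<psi>h - integral {x..b} \<psi>h'"
      by (intro integral_diff integrable_on_subinterval[OF D(3)] integrable_on_subinterval[OF D'(3)]) auto
    then show "\<bar>\<phi>h x - \<phi>h' x\<bar> \<le> \<bar>integral {x..b} (\<lambda>s. \<psi>h s - \<psi>h' s)\<bar>"
      using D(4)[OF x] D'(4)[OF x] by simp
  next
    fix j s B assume j: "j \<in> {1..M}" and s: "s \<in> {X M (j - 1)<..X M j}"
      and B: "\<And>t. t \<in> {X M (j - 1)..b} \<Longrightarrow> \<bar>\<phi>h t - \<phi>h' t\<bar> \<le> B"
    show "\<bar>\<psi>h s - \<psi>h' s\<bar> \<le> 0 + A * B"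
      using rhs_interpolant_diff_le[OF j s D(5) D'(5) B] D(2)[OF j] D'(2)[OF j]
      by (simp add: D(1)[OF j s] D'(1)[OF j s] left_diff_distrib sum_subtractf)
  qed (use M x in auto)
  then have eq: "\<bar>\<phi>h x - \<phi>h' x\<bar> \<le> 0" if "x \<in> {0..b}" for x using that by simp
  have p: "pt M j l \<in> {0..b}" by (rule pt_in[OF j l])
  have "\<bar>rhs \<phi>h (pt M j l) - rhs \<phi>h' (pt M j l)\<bar> \<le> A0 * 0"
    using p by (intro rhs_lipschitz p continuous_on_subset[OF D(5)] continuous_on_subset[OF D'(5)] eq) auto
  then show ?thesis using D(2)[OF j l] D'(2)[OF j l] by simp
qed

text \<open>The error \<open>\<psi> - \<psi>h\<close> is the interpolation error of \<open>\<psi>\<close> plus the interpolant of the difference of the right-hand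
  sides of \<open>\<phi>\<close> and \<open>\<phi>h\<close>. The latter is bounded by \<open>A\<close> times \<open>\<phi> - \<phi>h\<close>, itself an integral of the error,
  so stability bounds \<open>\<phi> - \<phi>h\<close> by the integral of the interpolation error. That an integral and not
  a supremum enters is what gives \<open>\<phi>h\<close> its better order.\<close>
lemma collocation_error:
  assumes fine: "fine_mesh M"
    and sol: "avide_solution b \<nu> a chi K \<phi>b \<phi> \<psi>"
    and app: "collocation_approx b \<nu> \<mu> q n \<xi> a chi K \<phi>b M Y \<psi>h \<phi>h"
    and E: "\<And>j s. \<lbrakk>j \<in> {1..M}; s \<in> {X M (j - 1)..X M j}\<rbrakk> \<Longrightarrow>
              \<bar>\<psi> s - (\<Sum>k=1..n. \<psi> (pt M j k) * L M j k s)\<bar> \<le> E j"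
  defines "\<delta> \<equiv> 2 * exp (4 * A * b) * (\<Sum>j=1..M. E j * (X M j - X M (j - 1)))"
  shows "x \<in> {0..b} \<Longrightarrow> \<bar>\<phi> x - \<phi>h x\<bar> \<le> \<delta>"
    and "\<lbrakk>j \<in> {1..M}; s \<in> {X M (j - 1)<..X M j}\<rbrakk> \<Longrightarrow> \<bar>\<psi> s - \<psi>h s\<bar> \<le> E j + A * \<delta>"
    and "(\<lambda>s. \<psi> s - \<psi>h s) integrable_on {0..b}" "continuous_on {0..b} (\<lambda>x. \<phi> x - \<phi>h x)"
proof -
  have M: "0 < M" and H: "exp (4 * A * (b * (1 + 2 * q) / real M)) \<le> 2"
    using fine by (auto simp: fine_mesh_def)
  note D = collocation_approxD[OF M app]
  have deriv: "(\<phi> has_real_derivative \<psi> x) (at x within {0..b})"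
    and rhs: "\<psi> x = rhs \<phi> x" if "x \<in> {0..b}" for x
    using sol that unfolding avide_solution_def by blast+
  have phib: "\<phi> b = \<phi>b" using sol unfolding avide_solution_def by blast
  have cont: "continuous_on {0..b} \<phi>"
    using deriv by (rule DERIV_continuous_on)
  have FTC: "(\<psi> has_integral (\<phi>b - \<phi> x)) {x..b}" if "x \<in> {0..b}" for x
    unfolding phib[symmetric] using that
    by (intro fundamental_theorem_of_calculus)
       (auto simp flip: has_real_derivative_iff_has_vector_derivative intro: DERIV_subset[OF deriv])
  have int\<psi>: "\<psi> integrable_on {0..b}" using FTC[of 0] b by auto
  show int: "(\<lambda>s. \<psi> s - \<psi>h s) integrable_on {0..b}" by (intro integrable_diff D int\<psi>)
  show contd: "continuous_on {0..b} (\<lambda>x. \<phi> x - \<phi>h x)" by (intro continuous_intros D cont)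
  have loc: "\<bar>\<psi> s - \<psi>h s\<bar> \<le> E j + A * B"
    if j: "j \<in> {1..M}" and s: "s \<in> {X M (j - 1)<..X M j}"
      and B: "\<And>t. t \<in> {X M (j - 1)..b} \<Longrightarrow> \<bar>\<phi> t - \<phi>h t\<bar> \<le> B" for j s B
  proof -
    have "(\<Sum>k=1..n. (rhs \<phi> (pt M j k) - rhs \<phi>h (pt M j k)) * L M j k s)
        = (\<Sum>k=1..n. \<psi> (pt M j k) * L M j k s) - \<psi>h s"
      unfolding D(1)[OF j s] sum_subtractf[symmetric] left_diff_distrib
      using rhs[OF pt_in(2)[OF j]] D(2)[OF j] by (intro sum.cong) auto
    then show ?thesis
      using rhs_interpolant_diff_le[OF j s cont D(5) B] E[OF j, of s] s by (simp add: abs_le_iff) 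
  qed
  have E0: "0 \<le> E j" if j: "j \<in> {1..M}" for j
  proof -
    have "X M j \<in> {X M (j - 1)..X M j}" using cell_ends[OF j] by auto
    from order_trans[OF abs_ge_zero E[OF j this]] show ?thesis .
  qed
  show *: "\<bar>\<phi> x - \<phi>h x\<bar> \<le> \<delta>" if x: "x \<in> {0..b}" for x
    unfolding \<delta>_def
  proof (rule volterra_stability[OF mono_X _ _ mesh_size H A_pos int contd _ E0 loc x])
    fix x assume x: "x \<in> {0..b}"
    then have "integral {x..b} (\<lambda>s. \<psi> s - \<psi>h s) = integral {x..b} \<psi> - integral {x..b} \<psi>h"
      by (intro integral_diff integrable_on_subinterval[OF int\<psi>] integrable_on_subinterval[OF D(3)]) auto
    then show "\<bar>\<phi> x - \<phi>h x\<bar> \<le> \<bar>integral {x..b} (\<lambda>s. \<psi> s - \<psi>h s)\<bar>"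
      using D(4)[OF x] integral_unique[OF FTC[OF x]] by simp
  qed (use M in auto)
  show "\<bar>\<psi> s - \<psi>h s\<bar> \<le> E j + A * \<delta>" if "j \<in> {1..M}" "s \<in> {X M (j - 1)<..X M j}"
    using that cell_ends[OF that(1)] by (intro loc *) auto
qed

end

section \<open>Convergence rates\<close>

text \<open>The point 0 lies in no mesh interval and forms a null set. Measurability has to be supplied because the
  essential supremum of a non-measurable function is infinite.\<close>
lemma Linf_norm_le:
  assumes f: "f integrable_on {0..b}"
    and bound: "\<And>x. x \<in> {0<..b} \<Longrightarrow> \<bar>f x\<bar> \<le> c"
  shows "Linf_norm b f \<le> ereal c"
  unfolding Linf_norm_def
proof (rule esssup_I)
  show "(\<lambda>x. ereal \<bar>f x\<bar>) \<in> borel_measurable (lebesgue_on {0..b})"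
    using integrable_imp_measurable[OF f] by measurable
  have "AE x in lebesgue. x \<noteq> (0 :: real)"
    by (intro AE_completion AE_lborel_singleton)
  then show "AE x in lebesgue_on {0..b}. ereal \<bar>f x\<bar> \<le> ereal c"
    by (subst AE_restrict_space_iff) (auto elim!: eventually_mono intro!: bound)
qed

text \<open>As a function of \<open>i\<close> the left-hand side is monotone, so its maximum is at the singularity
  (\<open>i = 0\<close>) or at the opposite end.\<close>
lemma grading_sup_le:
  fixes p n :: real
  assumes "i < M"
  shows "real M powr (- p) * real (Suc i) powr (p - n) \<le> real M powr (- min p n)"
proof (cases "p \<ge> n")
  case True
  have "real M powr (- p) * real (Suc i) powr (p - n) \<le> real M powr (- p) * real M powr (p - n)"
    using True assms by (intro mult_left_mono powr_mono2) auto
  also have "\<dots> = real M powr (- min p n)"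
    using True by (simp add: powr_add[symmetric] min_def)
  finally show ?thesis .
next
  case False
  have "real (Suc i) powr (p - n) \<le> real (Suc i) powr 0"
    using False by (intro powr_mono) auto
  then have "real M powr (- p) * real (Suc i) powr (p - n) \<le> real M powr (- p) * 1"
    by (intro mult_left_mono) auto
  then show ?thesis using False by (simp add: min_def)
qed

text \<open>The mesh steps add \<open>q - 1\<close> to the exponent of \<open>Suc (M - j)\<close> and \<open>- q\<close> to that of \<open>M\<close>, which leaves the power
  sum governed by \<open>varpi (q + p) n\<close>.\<close>
lemma graded_cell_sum_le:
  fixes p n :: real
  assumes "0 < b" "0 < q"
  obtains C where "0 \<le> C" and "\<And>M. 2 \<le> M \<Longrightarrow>
     (\<Sum>j=1..M. real M powr (- p) * real (Suc (M - j)) powr (p - n)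
          * (node b q M j - node b q M (j - 1))) \<le> C * varpi (q + p) n M"
proof -
  obtain C where C: "\<And>M. 2 \<le> M \<Longrightarrow> (\<Sum>i<M. real (Suc i) powr ((q + p) - 1 - n))
     \<le> C * (real M powr (q + p) * varpi (q + p) n M)" "0 \<le> C"
    by (rule sum_powr_le_varpi[where s = "q + p" and n = n]) blast
  define c where "c = b * (1 + 2 * q)"
  have c: "0 \<le> c" using assms by (simp add: c_def)
  show ?thesis
  proof (rule that[of "c * C"])
    show "0 \<le> c * C" using c C(2) by simp
    fix M :: nat assume M: "2 \<le> M"
    have "(\<Sum>j=1..M. real M powr (- p) * real (Suc (M - j)) powr (p - n) * (node b q M j - node b q M (j - 1)))
      \<le> (\<Sum>j=1..M. c * real M powr (- (q + p)) * real (Suc (M - j)) powr ((q + p) - 1 - n))"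
    proof (rule sum_mono)
      fix j assume j: "j \<in> {1..M}"
      have "real M powr (- p) * real (Suc (M - j)) powr (p - n) * (node b q M j - node b q M (j - 1))
        \<le> real M powr (- p) * real (Suc (M - j)) powr (p - n)
            * (c * real M powr (- q) * real (Suc (M - j)) powr (q - 1))"
        unfolding c_def by (intro mult_left_mono node_step_le assms j) auto
      also have "\<dots> = c * (real M powr (- p) * real M powr (- q))
          * (real (Suc (M - j)) powr (p - n) * real (Suc (M - j)) powr (q - 1))"
        by (simp only: mult_ac)
      also have "\<dots> = c * real M powr (- (q + p)) * real (Suc (M - j)) powr ((q + p) - 1 - n)"
      proof -
        have "- p + - q = - (q + p)" "p - n + (q - 1) = (q + p) - 1 - n" by simp_all
        then show ?thesis by (simp only: powr_add[symmetric])
      qed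
      finally show "real M powr (- p) * real (Suc (M - j)) powr (p - n) * (node b q M j - node b q M (j - 1))
        \<le> c * real M powr (- (q + p)) * real (Suc (M - j)) powr ((q + p) - 1 - n)" .
    qed
    also have "\<dots> = c * real M powr (- (q + p)) * (\<Sum>j=1..M. real (Suc (M - j)) powr ((q + p) - 1 - n))"
      by (simp only: sum_distrib_left)
    also have "(\<Sum>j=1..M. real (Suc (M - j)) powr ((q + p) - 1 - n))
        = (\<Sum>i<M. real (Suc i) powr ((q + p) - 1 - n))"
      by (rule sum.reindex_bij_witness[of _ "\<lambda>i. M - i" "\<lambda>j. M - j"]) auto
    also have "c * real M powr (- (q + p)) * (\<Sum>i<M. real (Suc i) powr ((q + p) - 1 - n))
        \<le> c * real M powr (- (q + p)) * (C * (real M powr (q + p) * varpi (q + p) n M))"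
      using c by (intro mult_left_mono C M) auto
    also have "\<dots> = c * C * (real M powr (- (q + p)) * real M powr (q + p)) * varpi (q + p) n M"
      by (simp only: mult_ac)
    also have "real M powr (- (q + p)) * real M powr (q + p) = 1"
      using M by (simp add: powr_add[symmetric])
    finally show "(\<Sum>j=1..M. real M powr (- p) * real (Suc (M - j)) powr (p - n)
        * (node b q M j - node b q M (j - 1))) \<le> c * C * varpi (q + p) n M" by simp
  qed
qed

lemma interpolation_error_on_cells:
  fixes \<psi> :: "real \<Rightarrow> real"
  assumes b: "0 < b" and q: "0 < q" and \<mu>: "0 < \<mu>" and \<gamma>: "0 < \<gamma>" and n: "2 \<le> n"
    and \<xi>: "inj_on \<xi> {1..n}" "\<xi> ` {1..n} \<subseteq> {0..1}"
    and f: "(\<lambda>\<rho>. \<psi> (tau b \<mu> \<rho>)) \<in> weighted_C n \<gamma> b \<mu>"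
  obtains C where "0 \<le> C" and "\<And>M j s. \<lbrakk>2 \<le> M; j \<in> {1..M}; s \<in> {node b q M (j - 1)..node b q M j}\<rbrakk> \<Longrightarrow>
     \<bar>\<psi> s - (\<Sum>k=1..n. \<psi> (colloc_pt b \<mu> q \<xi> M j k) * frac_lagrange b \<mu> q n \<xi> M j k s)\<bar>
       \<le> C * log_factor n \<gamma> M * (real M powr (- (q * \<mu> * min n \<gamma>))
           * real (Suc (M - j)) powr (q * \<mu> * min n \<gamma> - n))"
proof -
  obtain C where C: "0 \<le> C" and taylor: "\<And>M j. \<lbrakk>2 \<le> M; j \<in> {1..M}\<rbrakk> \<Longrightarrow>
     \<exists>c. \<forall>\<theta>\<in>{0..1}. \<bar>\<psi> (tau b \<mu> (cell_point b \<mu> q M j \<theta>)) - (\<Sum>k<n. c k * \<theta> ^ k)\<bar>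
       \<le> C * log_factor n \<gamma> M * real M powr (- (q * \<mu> * min n \<gamma>))
           * real (Suc (M - j)) powr (q * \<mu> * min n \<gamma> - n)"
    by (rule taylor_cell_bound[OF b q \<mu> \<gamma> n f]) blast
  let ?\<Lambda> = "1 + lebesgue_bound \<xi> {1..n}"
  show ?thesis
  proof (rule that[of "?\<Lambda> * C"])
    show "0 \<le> ?\<Lambda> * C" using C lebesgue_bound_nonneg[of \<xi> "{1..n}"] by simp
    fix M j s assume M: "2 \<le> M" and j: "j \<in> {1..M}" and s: "s \<in> {node b q M (j - 1)..node b q M j}"
    define F where "F \<theta> = \<psi> (tau b \<mu> (cell_point b \<mu> q M j \<theta>))" for \<theta>
    define \<theta> where "\<theta> = cell_coord b \<mu> q M j s"
    define R where "R = C * log_factor n \<gamma> M * real M powr (- (q * \<mu> * min n \<gamma>))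
           * real (Suc (M - j)) powr (q * \<mu> * min n \<gamma> - n)"
    obtain c where c: "\<And>t. t \<in> {0..1} \<Longrightarrow> \<bar>F t - (\<Sum>k<n. c k * t ^ k)\<bar> \<le> R"
      using taylor[OF M j] unfolding F_def R_def by blast
    have \<theta>: "\<theta> \<in> {0..1}" "F \<theta> = \<psi> s"
      using cell_coord_in[OF b q \<mu> j s] by (simp_all only: \<theta>_def F_def)
    have "\<bar>F \<theta> - (\<Sum>k\<in>{1..n}. F (\<xi> k) * lagrange_basis \<xi> {1..n} k \<theta>)\<bar> \<le> ?\<Lambda> * R"
      by (rule lagrange_interpolation_error[OF \<xi>(1) _ \<xi>(2) _ _ c \<theta>(1)]) (use n in auto)
    moreover have "(\<Sum>k\<in>{1..n}. F (\<xi> k) * lagrange_basis \<xi> {1..n} k \<theta>)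
        = (\<Sum>k=1..n. \<psi> (colloc_pt b \<mu> q \<xi> M j k) * frac_lagrange b \<mu> q n \<xi> M j k s)"
      by (intro sum.cong)
         (simp_all add: frac_lagrange_eq_lagrange_basis[OF b q \<mu> j \<xi>(2)] F_def colloc_pt_eq \<theta>_def)
    ultimately show "\<bar>\<psi> s - (\<Sum>k=1..n. \<psi> (colloc_pt b \<mu> q \<xi> M j k) * frac_lagrange b \<mu> q n \<xi> M j k s)\<bar>
       \<le> ?\<Lambda> * C * log_factor n \<gamma> M * (real M powr (- (q * \<mu> * min n \<gamma>))
           * real (Suc (M - j)) powr (q * \<mu> * min n \<gamma> - n))"
      by (simp add: \<theta>(2) R_def mult_ac)
  qed
qed

theorem theorem6p1:
  fixes b \<nu> \<mu> q \<gamma> \<phi>b :: real and n :: nat and \<xi> :: "nat \<Rightarrow> real"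
    and a chi \<phi> \<psi> :: "real \<Rightarrow> real" and K :: "real \<Rightarrow> real \<Rightarrow> real"
  assumes "b > 0" and "0 < \<nu>" "\<nu> < 1" and "0 < \<mu>" "\<mu> < 1" and "q \<ge> 1" and "\<gamma> > 0"
    and "n \<ge> 2"
    and "0 \<le> \<xi> 1" and "strict_mono_on {1..n} \<xi>" and "\<xi> n \<le> 1"
    and "continuous_on {0..b} a" and "continuous_on {0..b} chi"
    and "continuous_on {(x, s). 0 \<le> x \<and> x \<le> s \<and> s \<le> b} (\<lambda>(x, s). K x s)"
    and "avide_solution b \<nu> a chi K \<phi>b \<phi> \<psi>"
    and "(\<lambda>\<rho>. \<psi> (tau b \<mu> \<rho>)) \<in> weighted_C n \<gamma> b \<mu>"
  shows "\<exists>M0 :: nat. \<exists>C :: real. M0 \<ge> 1 \<and> (\<forall>M>M0.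
    (\<exists>Y \<psi>h \<phi>h. collocation_approx b \<nu> \<mu> q n \<xi> a chi K \<phi>b M Y \<psi>h \<phi>h) \<and>
    (\<forall>Y \<psi>h \<phi>h Y' \<psi>h' \<phi>h'.
       collocation_approx b \<nu> \<mu> q n \<xi> a chi K \<phi>b M Y \<psi>h \<phi>h \<longrightarrow>
       collocation_approx b \<nu> \<mu> q n \<xi> a chi K \<phi>b M Y' \<psi>h' \<phi>h' \<longrightarrow>
       (\<forall>j\<in>{1..M}. \<forall>l\<in>{1..n}. Y j l = Y' j l)) \<and>
    (\<forall>Y \<psi>h \<phi>h. collocation_approx b \<nu> \<mu> q n \<xi> a chi K \<phi>b M Y \<psi>h \<phi>h \<longrightarrow>
       Linf_norm b (\<lambda>x. \<psi> x - \<psi>h x) \<le> ereal (C *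
         (if real n < \<gamma> then real M powr (- min (q * \<mu> * real n) (real n))
          else if real n = \<gamma> then real M powr (- min (q * \<mu> * real n) (real n)) * ln (real M)
          else real M powr (- min (q * \<mu> * \<gamma>) (real n)))) \<and>
       Linf_norm b (\<lambda>x. \<phi> x - \<phi>h x) \<le> ereal (C *
         (if real n \<noteq> \<gamma> then varpi (q * (1 + \<mu> * min (real n) \<gamma>)) (real n) M
          else varpi (q * (\<mu> * real n + 1)) (real n) M * ln (real M)))))"
proof -
  note b = assms(1) and \<nu> = assms(2) and \<mu> = assms(4) and q = assms(6) and \<gamma> = assms(7) and n = assms(8)
  note sol = assms(15)
  have q0: "0 < q" using q by simp
  have \<xi>_inj: "inj_on \<xi> {1..n}" using assms(10) by (rule strict_mono_on_imp_inj_on)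
  have \<xi>_mono: "\<xi> i \<le> \<xi> j" if "i \<in> {1..n}" "j \<in> {1..n}" "i \<le> j" for i j
    using strict_mono_onD[OF assms(10), of i j] that by (cases "i = j") auto
  have \<xi>_in: "\<xi> ` {1..n} \<subseteq> {0..1}"
  proof
    fix t assume "t \<in> \<xi> ` {1..n}"
    then obtain l where l: "l \<in> {1..n}" "t = \<xi> l" by blast
    have "\<xi> 1 \<le> \<xi> l" "\<xi> l \<le> \<xi> n" using l n by (auto intro!: \<xi>_mono)
    then show "t \<in> {0..1}" using assms(9,11) l by simp
  qed
  obtain A0 where A0: "0 < A0" "\<And>x f g B. \<lbrakk>x \<in> {0..b}; continuous_on {x..b} f; continuous_on {x..b} g;
           \<And>t. t \<in> {x..b} \<Longrightarrow> \<bar>f t - g t\<bar> \<le> B\<rbrakk>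
         \<Longrightarrow> \<bar>avide_rhs b \<nu> a chi K f x - avide_rhs b \<nu> a chi K g x\<bar> \<le> A0 * B"
    by (rule avide_rhs_lipschitz[OF \<nu> assms(12,14), where chi = chi]) blast
  interpret collocation b \<nu> \<mu> q n \<xi> a chi K A0
    by unfold_locales (use b \<mu> q \<xi>_in A0 in auto)
  define p where "p = q * \<mu> * min (real n) \<gamma>"
  obtain C1 where C1: "0 \<le> C1" and interp: "\<And>M j s. \<lbrakk>2 \<le> M; j \<in> {1..M}; s \<in> {X M (j - 1)..X M j}\<rbrakk> \<Longrightarrow>
     \<bar>\<psi> s - (\<Sum>k=1..n. \<psi> (pt M j k) * L M j k s)\<bar>
       \<le> C1 * log_factor n \<gamma> M * (real M powr (- p) * real (Suc (M - j)) powr (p - n))"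
    unfolding p_def
    by (rule interpolation_error_on_cells[OF b q0 \<mu> \<gamma> n \<xi>_inj \<xi>_in assms(16)]) blast
  obtain C2 where C2: "0 \<le> C2" and graded: "\<And>M. 2 \<le> M \<Longrightarrow>
     (\<Sum>j=1..M. real M powr (- p) * real (Suc (M - j)) powr (p - n) * (X M j - X M (j - 1)))
       \<le> C2 * varpi (q + p) n M"
    by (rule graded_cell_sum_le[OF b q0, of p n]) blast
  define S where "S = 2 * exp (4 * A * b)"
  have S: "0 \<le> S" by (simp add: S_def)
  \<comment> \<open>The two summands are the constants of the two estimates; the exponent is \<open>p = r * g\<close> in the notation of the introduction.\<close>
  define C where "C = C1 * (1 + A * S * b) + S * C1 * C2"
  \<comment> \<open>The bound that makes \<open>exp (4 * A * (b * (1 + 2 * q) / M)) \<le> 2\<close>; the maximum with 1 ensures \<open>M \<ge> 2\<close>, hence \<open>ln M > 0\<close>.\<close>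
  define M0 where "M0 = max 1 (nat \<lceil>4 * A * (b * (1 + 2 * q)) / ln 2\<rceil>)"
  have fine: "fine_mesh M" and M2: "2 \<le> M" if "M > M0" for M
  proof -
    show "2 \<le> M" using that by (simp add: M0_def)
    have "4 * A * (b * (1 + 2 * q)) / ln 2 \<le> real M" using that unfolding M0_def by linarith
    then have "4 * A * (b * (1 + 2 * q) / real M) \<le> ln 2"
      using \<open>2 \<le> M\<close> by (simp add: field_simps)
    then have "exp (4 * A * (b * (1 + 2 * q) / real M)) \<le> exp (ln 2)" by (subst exp_le_cancel_iff)
    then show "fine_mesh M" using \<open>2 \<le> M\<close> by (simp add: fine_mesh_def)
  qed
  have err: "Linf_norm b (\<lambda>x. \<psi> x - \<psi>h x)
        \<le> ereal (C * (log_factor n \<gamma> M * real M powr (- min p n)))"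
      "Linf_norm b (\<lambda>x. \<phi> x - \<phi>h x) \<le> ereal (C * (log_factor n \<gamma> M * varpi (q + p) n M))"
    if "M > M0" and app: "collocation_approx b \<nu> \<mu> q n \<xi> a chi K \<phi>b M Y \<psi>h \<phi>h" for M Y \<psi>h \<phi>h
  proof -
    note M = M2[OF that(1)]
    define lf where "lf = log_factor n \<gamma> M"
    have lf: "0 \<le> lf" using M by (simp add: lf_def log_factor_def)
    define E where "E j = C1 * lf * (real M powr (- p) * real (Suc (M - j)) powr (p - n))" for j
    define \<sigma> where "\<sigma> = (\<Sum>j=1..M. E j * (X M j - X M (j - 1)))"
    have "\<bar>\<psi> s - (\<Sum>k=1..n. \<psi> (pt M j k) * L M j k s)\<bar> \<le> E j"
      if "j \<in> {1..M}" "s \<in> {X M (j - 1)..X M j}" for j s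
      using interp[OF M that] by (simp only: E_def lf_def)
    note err = collocation_error[OF fine[OF that(1)] sol app this, folded \<sigma>_def S_def]
    define e where "e = real M powr (- min p n)"
    have Ee: "E j \<le> C1 * lf * e" if "j \<in> {1..M}" for j
      unfolding E_def e_def using that C1 lf by (intro mult_left_mono grading_sup_le) auto
    have "\<sigma> \<le> (\<Sum>j=1..M. C1 * lf * e * (X M j - X M (j - 1)))"
      unfolding \<sigma>_def using cell_ends(3) by (intro sum_mono mult_right_mono Ee) auto
    also have "\<dots> = C1 * lf * e * (\<Sum>j=1..M. X M j - X M (j - 1))"
      by (simp only: sum_distrib_left)
    also have "(\<Sum>j=1..M. X M j - X M (j - 1)) = b"
      using sum_telescope''[of 0 M "X M"] M by (simp add: atLeastSucAtMost_greaterThanAtMost[symmetric])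
    finally have \<sigma>1: "\<sigma> \<le> C1 * lf * e * b" .
    have "\<sigma> = C1 * lf * (\<Sum>j=1..M. real M powr (- p) * real (Suc (M - j)) powr (p - n) * (X M j - X M (j - 1)))"
      unfolding \<sigma>_def E_def sum_distrib_left by (simp only: mult.assoc)
    also have "\<dots> \<le> C1 * lf * (C2 * varpi (q + p) n M)"
      using C1 lf M by (intro mult_left_mono graded) auto
    finally have \<sigma>2: "\<sigma> \<le> C1 * lf * (C2 * varpi (q + p) n M)" .
    have v0: "0 \<le> varpi (q + p) n M" using M by (simp add: varpi_def)
    show "Linf_norm b (\<lambda>x. \<psi> x - \<psi>h x) \<le> ereal (C * (log_factor n \<gamma> M * real M powr (- min p n)))"
    proof (rule Linf_norm_le[OF err(3)])
      fix x assume x: "x \<in> {0<..b}"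
      then have "X M 0 < x" "x \<le> X M M" using M by simp_all
      then obtain j where j: "j \<in> {1..M}" "x \<in> {X M (j - 1)<..X M j}" by (rule mesh_cell_exists)
      have "\<bar>\<psi> x - \<psi>h x\<bar> \<le> E j + A * (S * \<sigma>)" by (rule err(2)) (use j in auto)
      also have "\<dots> \<le> C1 * lf * e + A * (S * (C1 * lf * e * b))"
        using S A_pos \<sigma>1 by (intro add_mono Ee j mult_left_mono) auto
      also have "\<dots> = C1 * (1 + A * S * b) * (lf * e)" by (simp add: algebra_simps)
      also have "\<dots> \<le> C * (lf * e)"
        unfolding C_def using S C1 C2 lf by (intro mult_right_mono) (auto simp: e_def)
      finally show "\<bar>\<psi> x - \<psi>h x\<bar> \<le> C * (log_factor n \<gamma> M * real M powr (- min p n))"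
        by (simp only: lf_def e_def)
    qed
    show "Linf_norm b (\<lambda>x. \<phi> x - \<phi>h x) \<le> ereal (C * (log_factor n \<gamma> M * varpi (q + p) n M))"
    proof (rule Linf_norm_le[OF integrable_continuous_interval[OF err(4)]])
      fix x assume "x \<in> {0<..b}"
      then have "\<bar>\<phi> x - \<phi>h x\<bar> \<le> S * \<sigma>" by (intro err(1)) auto
      also have "\<dots> \<le> S * (C1 * lf * (C2 * varpi (q + p) n M))"
        using S \<sigma>2 by (intro mult_left_mono) auto
      also have "\<dots> = S * C1 * C2 * (lf * varpi (q + p) n M)" by (simp only: mult_ac)
      also have "\<dots> \<le> C * (lf * varpi (q + p) n M)"
        unfolding C_def using S C1 A_pos b lf v0 by (intro mult_right_mono) auto
      finally show "\<bar>\<phi> x - \<phi>h x\<bar> \<le> C * (log_factor n \<gamma> M * varpi (q + p) n M)"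
        by (simp only: lf_def)
    qed
  qed
  have psi_rate: "log_factor n \<gamma> M * real M powr (- min p n)
      = (if real n < \<gamma> then real M powr (- min (q * \<mu> * real n) (real n))
          else if real n = \<gamma> then real M powr (- min (q * \<mu> * real n) (real n)) * ln (real M)
          else real M powr (- min (q * \<mu> * \<gamma>) (real n)))" for M
    by (auto simp: log_factor_def p_def min_def[of "real n" \<gamma>])
  have phi_rate: "log_factor n \<gamma> M * varpi (q + p) n M
      = (if real n \<noteq> \<gamma> then varpi (q * (1 + \<mu> * min (real n) \<gamma>)) (real n) M
          else varpi (q * (\<mu> * real n + 1)) (real n) M * ln (real M))" for M
  proof -
    have "q + p = q * (1 + \<mu> * min (real n) \<gamma>)" by (simp add: p_def algebra_simps)
    moreover have "q + p = q * (\<mu> * real n + 1)" if "real n = \<gamma>"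
      using that by (simp add: p_def algebra_simps)
    ultimately show ?thesis
      by (cases "real n = \<gamma>") (simp_all only: log_factor_def if_True if_False not_False_eq_True
            not_True_eq_False simp_thms mult_1_left mult.commute[of "ln (real M)"])
  qed
  show ?thesis
  proof (rule exI[of _ M0], rule exI[of _ C], intro conjI allI impI ballI)
    show "1 \<le> M0" by (simp add: M0_def)
  next
    fix M assume "M0 < M"
    then show "\<exists>Y \<psi>h \<phi>h. collocation_approx b \<nu> \<mu> q n \<xi> a chi K \<phi>b M Y \<psi>h \<phi>h"
      by (intro collocation_solvable fine)
  next
    fix M Y \<psi>h \<phi>h Y' \<psi>h' \<phi>h' j l
    assume "M0 < M" "collocation_approx b \<nu> \<mu> q n \<xi> a chi K \<phi>b M Y \<psi>h \<phi>h"
      "collocation_approx b \<nu> \<mu> q n \<xi> a chi K \<phi>b M Y' \<psi>h' \<phi>h'" "j \<in> {1..M}" "l \<in> {1..n}"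
    then show "Y j l = Y' j l" by (intro collocation_unique fine)
  qed (simp_all only: psi_rate[symmetric] phi_rate[symmetric] err)
qed

end
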